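(* Let $X$ be a real Banach space, let $f\in S_{X^*}$ and $\varepsilon\in(0,1)$. Then $X$ has the Radon-Nikodym property if and only if there exists a function $t : X \to S_{X^*} \cap B(f,\varepsilon)$ such that every sequence $(x_n)_{n\in\mathbb{N}}$ in $X$, for which $\bigl(f(x_n) - \varepsilon \|x_n\|\bigr)_n$ is bounded below and $\langle t(x_n), x_{n+1} - x_n \rangle \leqslant 0$ for all $n \in \mathbb{N}$, converges in $X$.
   Context: $X^*$ is the dual of $X$, $S_{X^*}=\{g\in X^*:\|g\|=1\}$ its unit sphere, and $B(f,\varepsilon)=\{g\in X^*:\|f-g\|<\varepsilon\}$. For $g\in X^*$ and $x\in X$, $\langle g,x\rangle=g(x)$. Radon-Nikodym property: $X$ has the Radon-Nikodym property if for every non-empty closed convex bounded subset $C$ of $X$ and every $\eta>0$ there exist $g\in S_{X^*}$ and $c\in\mathbb{R}$ such that $\{x\in C: g(x)<c\}$ is non-empty and has diameter less than $\eta$. *)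

theory Defs
  imports "HOL-Analysis.Analysis"
begin

(* The dual of X is the type of bounded linear maps X \<Rightarrow>\<^sub>L real under the operator norm.
   The library's diameter is a supremum of reals, which is meaningful here because
   the slice of C is bounded. *)
definition radon_nikodym_property :: "'a::banach itself \<Rightarrow> bool" where
  "radon_nikodym_property _ \<longleftrightarrow>
     (\<forall>C :: 'a set. \<forall>\<eta> > 0. C \<noteq> {} \<longrightarrow> closed C \<longrightarrow> convex C \<longrightarrow> bounded C \<longrightarrow>
        (\<exists>g \<in> sphere (0 :: 'a \<Rightarrow>\<^sub>L real) 1. \<exists>c :: real.
           {x \<in> C. blinfun_apply g x < c} \<noteq> {} \<and>
           diameter {x \<in> C. blinfun_apply g x < c} < \<eta>))"

end

(*
  If X fails the property, take a set C all of whose slices have diameter at least eta. Whatever t is,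
  one can jump forever by at least eta/4 while decreasing t(x_n), staying in a neighbourhood of C.

  Conversely, suppose X has the property. On a closed convex set K on which the slices by functionals
  near g are bounded, some functional near g has a slice of small diameter: the set of points of K
  where functionals near g attain their minimum has a small slice, in an uncontrolled direction h. If z
  attains its minimum at a point of that slice, then the slices of K by z + s h, with s > 0 small, lie
  close to it (Ekeland and Hahn-Banach turn near-minimisers into minimisers). Removing small slices
  transfinitely assigns to every point an ordinal which does not increase along a sequence played
  against the slicing functionals. Each piece is sliced again, with functionals so close to the
  previous one that their limit t(x) works on all levels at once, so that the ordinals of all levels
  stabilise in turn and the sequence is Cauchy. The unbounded space X is cut into the layers between
  {phi >= -(m-1)} and {phi >= -m}, where phi = f - (eps/2) norm; points of a layer are separated from
  the previous one by functionals in B(f, eps/2), whose slices of the layer are bounded, and the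
  boundedness hypothesis on the sequence makes the layer index stabilise.
*)

theory Submission
  imports Defs
begin

subsection \<open>Sublinear functionals and the Hahn-Banach theorem\<close>

definition sublinear :: "('a::real_vector \<Rightarrow> real) \<Rightarrow> bool" where
  "sublinear p \<longleftrightarrow>
     (\<forall>v w. p (v + w) \<le> p v + p w) \<and> (\<forall>s v. 0 \<le> s \<longrightarrow> p (s *\<^sub>R v) = s * p v)"

text \<open>The sets \<open>F v\<close> hold competing values; adding or rescaling competitors gives
  competitors, so the infima inherit both laws. Asking only for \<open>c \<le> a + b\<close> covers
  infima over chains.\<close>

lemma sublinear_Inf:
  fixes F :: "'a::real_vector \<Rightarrow> real set"
  assumes ne: "\<And>v. F v \<noteq> {}" and bdd: "\<And>v. bdd_below (F v)"
    and add: "\<And>v w a b. a \<in> F v \<Longrightarrow> b \<in> F w \<Longrightarrow> \<exists>c \<in> F (v + w). c \<le> a + b"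
    and scale: "\<And>v a s. a \<in> F v \<Longrightarrow> 0 < s \<Longrightarrow> s * a \<in> F (s *\<^sub>R v)"
  shows "sublinear (\<lambda>v. Inf (F v))"
proof -
  have subadd: "Inf (F (v + w)) \<le> Inf (F v) + Inf (F w)" for v w
  proof -
    have "Inf (F (v + w)) - b \<le> Inf (F v)" if "b \<in> F w" for b
    proof (rule cInf_greatest[OF ne])
      fix a assume "a \<in> F v"
      then obtain c where "c \<in> F (v + w)" "c \<le> a + b" using add[OF _ \<open>b \<in> F w\<close>] by blast
      then have "Inf (F (v + w)) \<le> a + b" using cInf_lower[OF _ bdd] by fastforce
      then show "Inf (F (v + w)) - b \<le> a" by simp
    qed
    then have "Inf (F (v + w)) - Inf (F v) \<le> Inf (F w)"
      by (intro cInf_greatest[OF ne]) (smt (verit))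
    then show ?thesis by simp
  qed
  have le: "Inf (F (s *\<^sub>R v)) \<le> s * Inf (F v)" if "0 < s" for s v
  proof -
    have "Inf (F (s *\<^sub>R v)) / s \<le> Inf (F v)"
    proof (rule cInf_greatest[OF ne])
      fix a assume "a \<in> F v"
      then have "Inf (F (s *\<^sub>R v)) \<le> s * a"
        using scale that cInf_lower[OF _ bdd] by blast
      then show "Inf (F (s *\<^sub>R v)) / s \<le> a" using that by (simp add: field_simps)
    qed
    then show ?thesis using that by (simp add: field_simps)
  qed
  have eq: "Inf (F (s *\<^sub>R v)) = s * Inf (F v)" if "0 < s" for s v
  proof -
    have "Inf (F v) \<le> inverse s * Inf (F (s *\<^sub>R v))"
      using le[of "inverse s" "s *\<^sub>R v"] that by simp
    then have "s * Inf (F v) \<le> Inf (F (s *\<^sub>R v))" using that by (simp add: field_simps)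
    with le[OF that] show ?thesis by (simp add: antisym)
  qed
  \<comment> \<open>At the zero vector, scaling by 2 gives
    \<open>Inf (F 0) = 2 * Inf (F 0)\<close>.\<close>
  have "Inf (F (0 *\<^sub>R v)) = 0" for v using eq[of 2 0] by simp
  with eq subadd show ?thesis
    unfolding sublinear_def by (metis less_eq_real_def mult_zero_left)
qed

lemma sublinear_neg_le: "sublinear p \<Longrightarrow> - p (- v) \<le> p v"
proof -
  assume p: "sublinear p"
  have "p 0 = 0" using p unfolding sublinear_def by (metis mult_zero_left order_refl scaleR_zero_left)
  moreover have "p (v + - v) \<le> p v + p (- v)" using p unfolding sublinear_def by blast
  ultimately show ?thesis by simp
qed

text \<open>Take the infimum of \<open>p (v + s *\<^sub>R x) - s * p x\<close> over
  \<open>s \<ge> 0\<close>; subadditivity bounds it below by \<open>- p (- v)\<close>. At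
  \<open>v = - x\<close> the second bound reads \<open>q (- x) \<le> - p x\<close>, which forces
  linearity along \<open>x\<close>.\<close>

lemma sublinear_directional:
  assumes p: "sublinear p"
  obtains q where "sublinear q" "\<And>v. q v \<le> p v" "\<And>v. q v \<le> p (v + x) - p x"
proof -
  define F where "F v = (\<lambda>s. p (v + s *\<^sub>R x) - s * p x) ` {0..}" for v
  have hom: "p (s *\<^sub>R v) = s * p v" if "0 \<le> s" for s v using p that unfolding sublinear_def by blast
  have sub: "p (v + w) \<le> p v + p w" for v w using p unfolding sublinear_def by blast
  have bdd: "bdd_below (F v)" for v
  proof (rule bdd_belowI)
    fix a assume "a \<in> F v"
    then obtain s where s: "0 \<le> s" "a = p (v + s *\<^sub>R x) - s * p x" unfolding F_def by auto
    have "p (s *\<^sub>R x) \<le> p (v + s *\<^sub>R x) + p (- v)" using sub[of "v + s *\<^sub>R x" "- v"] by simp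
    then show "- p (- v) \<le> a" using s hom by simp
  qed
  have "sublinear (\<lambda>v. Inf (F v))"
  proof (rule sublinear_Inf)
    show "F v \<noteq> {}" for v unfolding F_def by auto
    show "bdd_below (F v)" for v by (rule bdd)
    show "\<exists>c \<in> F (v + w). c \<le> a + b" if "a \<in> F v" "b \<in> F w" for v w a b
    proof -
      obtain s where s: "0 \<le> s" "a = p (v + s *\<^sub>R x) - s * p x"
        using \<open>a \<in> F v\<close> unfolding F_def by auto
      obtain r where r: "0 \<le> r" "b = p (w + r *\<^sub>R x) - r * p x"
        using \<open>b \<in> F w\<close> unfolding F_def by auto
      have "p ((v + w) + (s + r) *\<^sub>R x) \<le> p (v + s *\<^sub>R x) + p (w + r *\<^sub>R x)"
        using sub[of "v + s *\<^sub>R x" "w + r *\<^sub>R x"] by (simp add: algebra_simps)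
      then have "p ((v + w) + (s + r) *\<^sub>R x) - (s + r) * p x \<le> a + b"
        using s r by (simp add: algebra_simps)
      moreover have "p ((v + w) + (s + r) *\<^sub>R x) - (s + r) * p x \<in> F (v + w)"
        unfolding F_def using s r by (auto intro!: image_eqI[where x = "s + r"])
      ultimately show ?thesis by blast
    qed
    show "s * a \<in> F (s *\<^sub>R v)" if "a \<in> F v" "0 < s" for v a s
    proof -
      obtain r where r: "0 \<le> r" "a = p (v + r *\<^sub>R x) - r * p x"
        using \<open>a \<in> F v\<close> unfolding F_def by auto
      have "s * p (v + r *\<^sub>R x) = p (s *\<^sub>R v + (s * r) *\<^sub>R x)"
        using hom[of s "v + r *\<^sub>R x"] that by (simp add: algebra_simps)
      then have "s * a = p (s *\<^sub>R v + (s * r) *\<^sub>R x) - (s * r) * p x"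
        unfolding r(2) by (simp add: right_diff_distrib mult.assoc)
      then show ?thesis unfolding F_def using r that by (auto intro!: image_eqI[where x = "s * r"])
    qed
  qed
  moreover have "Inf (F v) \<le> p v" for v
    by (rule cInf_lower[OF _ bdd]) (auto simp: F_def intro!: image_eqI[where x = 0])
  moreover have "Inf (F v) \<le> p (v + x) - p x" for v
    by (rule cInf_lower[OF _ bdd]) (auto simp: F_def intro!: image_eqI[where x = 1])
  ultimately show ?thesis using that by blast
qed

lemma minimal_sublinear_below:
  fixes p :: "'a::real_vector \<Rightarrow> real"
  assumes p: "sublinear p"
  obtains q where "sublinear q" "\<And>v. q v \<le> p v"
    "\<And>q'. sublinear q' \<Longrightarrow> (\<And>v. q' v \<le> q v) \<Longrightarrow> q' = q"
proof -
  define A where "A = {q. sublinear q \<and> (\<forall>v. q v \<le> p v)}"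
  \<comment> \<open>The order is reversed, so that a maximal element is a minimal
    functional.\<close>
  define P where "P q q' \<longleftrightarrow> (\<forall>v. q' v \<le> q v)" for q q' :: "'a \<Rightarrow> real"
  have "\<exists>m \<in> A. \<forall>a \<in> A. P m a \<longrightarrow> a = m"
  proof (rule predicate_Zorn)
    show "partial_order_on A (relation_of P A)"
      by (rule partial_order_on_relation_ofI)
         (auto simp: P_def fun_eq_iff intro: order_trans antisym)
    fix C assume C: "C \<in> Chains (relation_of P A)"
    have CA: "C \<subseteq> A" and tot: "\<And>a b. a \<in> C \<Longrightarrow> b \<in> C \<Longrightarrow> P a b \<or> P b a"
      using C unfolding Chains_def relation_of_def by auto
    show "\<exists>u \<in> A. \<forall>a \<in> C. P a u"
    proof (cases "C = {}")
      case True
      then show ?thesis using p unfolding A_def by auto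
    next
      case False
      define F where "F v = (\<lambda>q. q v) ` C" for v
      have bdd: "bdd_below (F v)" for v
      proof (rule bdd_belowI)
        fix a assume "a \<in> F v"
        then obtain q where q: "q \<in> C" "a = q v" unfolding F_def by auto
        have "- q (- v) \<le> q v" "q (- v) \<le> p (- v)"
          using q CA sublinear_neg_le[of q v] unfolding A_def by auto
        then show "- p (- v) \<le> a" using q by simp
      qed
      have low: "Inf (F v) \<le> q v" if "q \<in> C" for q v
        by (rule cInf_lower[OF _ bdd]) (use that in \<open>auto simp: F_def\<close>)
      have "sublinear (\<lambda>v. Inf (F v))"
      proof (rule sublinear_Inf)
        show "F v \<noteq> {}" for v unfolding F_def using False by auto
        show "bdd_below (F v)" for v by (rule bdd)
        show "\<exists>c \<in> F (v + w). c \<le> a + b" if "a \<in> F v" "b \<in> F w" for v w a b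
        proof -
          obtain q r where q: "q \<in> C" "a = q v" and r: "r \<in> C" "b = r w"
            using \<open>a \<in> F v\<close> \<open>b \<in> F w\<close> unfolding F_def by auto
          \<comment> \<open>In a chain the smaller of \<open>q\<close> and \<open>r\<close> serves
            at both points.\<close>
          obtain u where u: "u \<in> C" "u v \<le> a" "u w \<le> b"
            using tot[OF q(1) r(1)] q r unfolding P_def by auto
          have "sublinear u" using u CA unfolding A_def by blast
          then have "u (v + w) \<le> u v + u w" unfolding sublinear_def by blast
          then have "u (v + w) \<le> a + b" using u by simp
          then show ?thesis using u unfolding F_def by auto
        qed
        show "s * a \<in> F (s *\<^sub>R v)" if "a \<in> F v" "0 < s" for v a s
        proof -
          obtain q where q: "q \<in> C" "a = q v" using \<open>a \<in> F v\<close> unfolding F_def by auto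
          have "sublinear q" using q CA unfolding A_def by blast
          then have "s * a = q (s *\<^sub>R v)" using q \<open>0 < s\<close> unfolding sublinear_def by simp
          then show ?thesis unfolding F_def using q by blast
        qed
      qed
      moreover have "Inf (F v) \<le> p v" for v
      proof -
        obtain q where "q \<in> C" using False by blast
        then show ?thesis using low[of q v] CA order_trans unfolding A_def by blast
      qed
      ultimately have "(\<lambda>v. Inf (F v)) \<in> A" unfolding A_def by blast
      then show ?thesis unfolding P_def using low by (intro bexI[of _ "\<lambda>v. Inf (F v)"]) auto
    qed
  qed
  then obtain q where "q \<in> A" and min: "\<And>a. a \<in> A \<Longrightarrow> P q a \<Longrightarrow> a = q" by blast
  then show ?thesis
    by (intro that[of q]) (auto simp: A_def P_def intro: order_trans)
qed

text \<open>A minimal sublinear \<open>q\<close> is additive: its directional minorant along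
  \<open>w\<close> must be \<open>q\<close> itself, so \<open>q v + q w \<le> q (v + w)\<close>.
  Replacing \<open>p\<close> beforehand by its directional minorant along \<open>x\<close> gives
  \<open>q (- x) \<le> - p x\<close>, hence the value at \<open>x\<close>.\<close>

theorem Hahn_Banach_sublinear:
  fixes p :: "'a::real_vector \<Rightarrow> real"
  assumes p: "sublinear p"
  obtains F where "linear F" "\<And>v. F v \<le> p v" "F x = p x"
proof -
  obtain p' where p': "sublinear p'" "\<And>v. p' v \<le> p v" "\<And>v. p' v \<le> p (v + x) - p x"
    using sublinear_directional[OF p] by metis
  obtain q where q: "sublinear q" "\<And>v. q v \<le> p' v"
    and min: "\<And>q'. sublinear q' \<Longrightarrow> (\<And>v. q' v \<le> q v) \<Longrightarrow> q' = q"
    using minimal_sublinear_below[OF p'(1)] by metis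
  have add: "q (v + w) = q v + q w" for v w
  proof -
    obtain q' where q': "sublinear q'" "\<And>v. q' v \<le> q v" "\<And>v. q' v \<le> q (v + w) - q w"
      using sublinear_directional[OF q(1)] by metis
    have "q' = q" using min q' by blast
    then have "q v \<le> q (v + w) - q w" using q'(3) by metis
    moreover have "q (v + w) \<le> q v + q w" using q(1) unfolding sublinear_def by blast
    ultimately show ?thesis by simp
  qed
  have hom: "q (s *\<^sub>R v) = s * q v" if "0 \<le> s" for s v
    using q(1) that unfolding sublinear_def by blast
  have q0: "q 0 = 0" using add[of 0 0] by simp
  have neg: "q (- v) = - q v" for v using add[of v "- v"] q0 by simp
  have lin: "linear q"
  proof (rule linearI)
    show "q (v + w) = q v + q w" for v w by (rule add)
    show "q (s *\<^sub>R v) = s *\<^sub>R q v" for s v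
      using hom[of s v] hom[of "- s" v] neg[of "s *\<^sub>R v"] by (cases "0 \<le> s") auto
  qed
  have "q (- x) \<le> p (- x + x) - p x" using q(2) p'(3) order_trans by blast
  moreover have "p 0 = 0"
    using p unfolding sublinear_def by (metis mult_zero_left order_refl scaleR_zero_left)
  ultimately have "p x \<le> q x" using neg by simp
  moreover have below: "q v \<le> p v" for v using q(2) p'(2) order_trans by blast
  ultimately show ?thesis using that[of q] lin antisym by blast
qed

section \<open>Continuous functionals below a sublinear bound\<close>

lemma blinfun_below_norm:
  fixes p :: "'a::real_normed_vector \<Rightarrow> real"
  assumes p: "sublinear p" and le: "\<And>v. p v \<le> K * norm v" and K: "0 \<le> K"
  obtains h :: "'a \<Rightarrow>\<^sub>L real" where "norm h \<le> K" "\<And>v. h v \<le> p v" "h x = p x"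
proof -
  obtain F where F: "linear F" "\<And>v. F v \<le> p v" "F x = p x"
    using Hahn_Banach_sublinear[OF p] by metis
  have bound: "norm (F v) \<le> norm v * K" for v
    using F(2)[of v] F(2)[of "- v"] le[of v] le[of "- v"] linear_neg[OF F(1), of v]
    by (simp add: mult.commute)
  then have "bounded_linear F" using F(1) by (intro bounded_linear_intro) (auto simp: linear_add linear_scale)
  then have eq: "blinfun_apply (Blinfun F) = F" by (rule bounded_linear_Blinfun_apply)
  have "norm (Blinfun F) \<le> K"
    by (rule norm_blinfun_bound[OF K]) (use bound eq in \<open>simp add: mult.commute\<close>)
  then show ?thesis using that[of "Blinfun F"] F eq by simp
qed

lemma norming_functional:
  obtains h :: "'a::real_normed_vector \<Rightarrow>\<^sub>L real" where "norm h \<le> 1" "h x = norm x"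
proof -
  have "sublinear (norm :: 'a \<Rightarrow> real)"
    unfolding sublinear_def by (auto simp: norm_triangle_ineq)
  then show ?thesis using blinfun_below_norm[of norm 1 x] that by auto
qed

text \<open>The subdifferential sum rule for the sum of a functional, the indicator of \<open>K\<close> and a cone
  with apex \<open>y\<close>.\<close>

lemma minimiser_of_nearby_functional:
  fixes z :: "'a::real_normed_vector \<Rightarrow>\<^sub>L real"
  assumes K: "convex K" "y \<in> K" and g: "0 \<le> \<gamma>"
    and min: "\<And>w. w \<in> K \<Longrightarrow> z y \<le> z w + \<gamma> * norm (w - y)"
  obtains z' :: "'a \<Rightarrow>\<^sub>L real" where "norm (z' - z) \<le> \<gamma>" "\<And>w. w \<in> K \<Longrightarrow> z' y \<le> z' w"
proof -
  \<comment> \<open>A functional below these infima is below \<open>\<gamma> * norm\<close> (take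
    \<open>s = 0\<close>), and its value at \<open>y - w\<close> is at most \<open>z (w - y)\<close>
    (take \<open>s = 1\<close>): these give the two conclusions.\<close>
  define F where
    "F v = {s * z (w - y) + \<gamma> * norm (v + s *\<^sub>R (w - y)) | s w. 0 \<le> s \<and> w \<in> K}" for v
  have lower: "- \<gamma> * norm v \<le> a" if "a \<in> F v" for v a
  proof -
    obtain s w where sw: "0 \<le> s" "w \<in> K" "a = s * z (w - y) + \<gamma> * norm (v + s *\<^sub>R (w - y))"
      using \<open>a \<in> F v\<close> unfolding F_def by blast
    have "s * norm (w - y) \<le> norm (v + s *\<^sub>R (w - y)) + norm v"
      using norm_triangle_ineq4[of "v + s *\<^sub>R (w - y)" v] sw(1) by simp
    then have "\<gamma> * (s * norm (w - y)) \<le> \<gamma> * (norm (v + s *\<^sub>R (w - y)) + norm v)"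
      by (rule mult_left_mono[OF _ g])
    \<comment> \<open>Near-minimality of \<open>y\<close> is what keeps the infima finite.\<close>
    moreover have "0 \<le> s * (z (w - y) + \<gamma> * norm (w - y))"
      using sw min[OF sw(2)] by (simp add: blinfun.diff_right)
    ultimately show ?thesis using sw(3) by (simp add: algebra_simps)
  qed
  have bdd: "bdd_below (F v)" for v using lower by (rule bdd_belowI)
  have "sublinear (\<lambda>v. Inf (F v))"
  proof (rule sublinear_Inf)
    show "F v \<noteq> {}" for v unfolding F_def using K(2) by blast
    show "bdd_below (F v)" for v by (rule bdd)
    show "\<exists>c \<in> F (v + v'). c \<le> a + b" if "a \<in> F v" "b \<in> F v'" for v v' a b
    proof -
      obtain s w where s: "0 \<le> s" "w \<in> K" "a = s * z (w - y) + \<gamma> * norm (v + s *\<^sub>R (w - y))"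
        using \<open>a \<in> F v\<close> unfolding F_def by auto
      obtain r u where r: "0 \<le> r" "u \<in> K" "b = r * z (u - y) + \<gamma> * norm (v' + r *\<^sub>R (u - y))"
        using \<open>b \<in> F v'\<close> unfolding F_def by auto
      \<comment> \<open>Convexity merges two directions of the cone into one; if both coefficients
        vanish, \<open>y\<close> serves.\<close>
      obtain k where k: "k \<in> K" "(s + r) *\<^sub>R (k - y) = s *\<^sub>R (w - y) + r *\<^sub>R (u - y)"
      proof (cases "s + r = 0")
        case True
        then have "s = 0" "r = 0" using s(1) r(1) by auto
        then show ?thesis using that[of y] K by auto
      next
        case False
        then have "0 < s + r" using s r by simp
        have "(s / (s + r)) *\<^sub>R w + (r / (s + r)) *\<^sub>R u \<in> K"
          using K(1) s r \<open>0 < s + r\<close> by (intro convexD) (auto simp: add_divide_distrib[symmetric])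
        moreover have "(s + r) *\<^sub>R ((s / (s + r)) *\<^sub>R w + (r / (s + r)) *\<^sub>R u - y)
            = s *\<^sub>R (w - y) + r *\<^sub>R (u - y)"
          using \<open>s + r \<noteq> 0\<close> by (simp add: scaleR_diff_right scaleR_add_right scaleR_add_left)
        ultimately show ?thesis using that by blast
      qed
      have "(s + r) * z (k - y) = s * z (w - y) + r * z (u - y)"
        using arg_cong[OF k(2), of "blinfun_apply z"] by (simp add: blinfun.add_right blinfun.scaleR_right)
      moreover have "norm ((v + v') + (s + r) *\<^sub>R (k - y))
          \<le> norm (v + s *\<^sub>R (w - y)) + norm (v' + r *\<^sub>R (u - y))"
        unfolding k(2) using norm_triangle_ineq[of "v + s *\<^sub>R (w - y)" "v' + r *\<^sub>R (u - y)"]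
        by (simp add: algebra_simps)
      then have "\<gamma> * norm ((v + v') + (s + r) *\<^sub>R (k - y))
          \<le> \<gamma> * (norm (v + s *\<^sub>R (w - y)) + norm (v' + r *\<^sub>R (u - y)))"
        by (rule mult_left_mono[OF _ g])
      ultimately have "(s + r) * z (k - y) + \<gamma> * norm ((v + v') + (s + r) *\<^sub>R (k - y)) \<le> a + b"
        using s r by (simp add: algebra_simps)
      moreover have "(s + r) * z (k - y) + \<gamma> * norm ((v + v') + (s + r) *\<^sub>R (k - y)) \<in> F (v + v')"
        unfolding F_def using s r k(1) by (auto intro!: exI[of _ "s + r"] exI[of _ k])
      ultimately show ?thesis by blast
    qed
    show "s * a \<in> F (s *\<^sub>R v)" if "a \<in> F v" "0 < s" for v a s
    proof -
      obtain r w where r: "0 \<le> r" "w \<in> K" "a = r * z (w - y) + \<gamma> * norm (v + r *\<^sub>R (w - y))"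
        using \<open>a \<in> F v\<close> unfolding F_def by blast
      have "s * norm (v + r *\<^sub>R (w - y)) = norm (s *\<^sub>R v + (s * r) *\<^sub>R (w - y))"
        using norm_scaleR[of s "v + r *\<^sub>R (w - y)"] that(2) by (simp add: scaleR_add_right)
      then have "s * a = (s * r) * z (w - y) + \<gamma> * norm (s *\<^sub>R v + (s * r) *\<^sub>R (w - y))"
        using r(3) by (simp add: algebra_simps)
      then show ?thesis unfolding F_def using r that by (auto intro!: exI[of _ "s * r"] exI[of _ w])
    qed
  qed
  moreover have "Inf (F v) \<le> \<gamma> * norm v" for v
  proof (rule cInf_lower[OF _ bdd])
    show "\<gamma> * norm v \<in> F v"
      unfolding F_def mem_Collect_eq using K(2) by (intro exI[of _ "0::real"] exI[of _ y]) simp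
  qed
  ultimately obtain h :: "'a \<Rightarrow>\<^sub>L real" where h: "norm h \<le> \<gamma>" "\<And>v. h v \<le> Inf (F v)"
    using blinfun_below_norm[OF _ _ g] by metis
  have "(z + h) y \<le> (z + h) w" if "w \<in> K" for w
  proof -
    have "h (- (w - y)) \<le> Inf (F (- (w - y)))" by (rule h(2))
    also have "\<dots> \<le> z (w - y)"
      by (rule cInf_lower[OF _ bdd])
         (use that in \<open>auto simp: F_def intro!: exI[of _ 1] exI[of _ w]\<close>)
    finally show ?thesis by (simp add: blinfun.diff_right blinfun.add_left)
  qed
  then show ?thesis using that[of "z + h"] h(1) by simp
qed

subsection \<open>Ekeland's variational principle\<close>

text \<open>\<open>S x\<close> holds the points whose gain over \<open>x\<close> pays for their
  distance from \<open>x\<close>, a transitive relation. Greedy choices, optimal up to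
  \<open>(1/2) ^ n\<close>, make these sets shrink to a single point \<open>y'\<close>, on which
  nothing improves.\<close>

lemma Ekeland_blinfun:
  fixes z :: "'a::banach \<Rightarrow>\<^sub>L real"
  assumes K: "closed K" "y \<in> K" and low: "\<And>w. w \<in> K \<Longrightarrow> b \<le> z w" and g: "0 < \<gamma>"
  obtains y' where "y' \<in> K" "z y' + \<gamma> * norm (y' - y) \<le> z y"
    "\<And>w. w \<in> K \<Longrightarrow> z y' \<le> z w + \<gamma> * norm (w - y')"
proof -
  define S where "S x = {w \<in> K. z w + \<gamma> * norm (w - x) \<le> z x}" for x
  have self: "x \<in> S x" if "x \<in> K" for x using that unfolding S_def by simp
  have trans: "S w \<subseteq> S x" if "w \<in> S x" for w x
  proof
    fix u assume u: "u \<in> S w"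
    have "\<gamma> * norm (u - x) \<le> \<gamma> * (norm (u - w) + norm (w - x))"
      using norm_triangle_ineq[of "u - w" "w - x"] g by (intro mult_left_mono) auto
    then show "u \<in> S x" using u that unfolding S_def by (simp add: algebra_simps)
  qed
  have bddS: "bdd_below (blinfun_apply z ` S x)" for x
    using low unfolding S_def by (intro bdd_belowI[of _ b]) auto
  have ex: "\<exists>w. w \<in> S x \<and> z w < Inf (blinfun_apply z ` S x) + (1/2) ^ n" if "x \<in> K" for x and n :: nat
  proof -
    have "blinfun_apply z ` S x \<noteq> {}" using self[OF that] by blast
    then show ?thesis
      using cInf_lessD[of "blinfun_apply z ` S x" "Inf (blinfun_apply z ` S x) + (1/2) ^ n"] by auto
  qed
  obtain X where X0: "X 0 = y" and XK: "\<And>n. X n \<in> K"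
    and XS: "\<And>n. X (Suc n) \<in> S (X n) \<and> z (X (Suc n)) < Inf (blinfun_apply z ` S (X n)) + (1/2) ^ n"
  proof -
    define X where "X = rec_nat y (\<lambda>n x. SOME w. w \<in> S x \<and> z w < Inf (blinfun_apply z ` S x) + (1/2) ^ n)"
    have step: "X n \<in> K \<Longrightarrow> X (Suc n) \<in> S (X n) \<and> z (X (Suc n)) < Inf (blinfun_apply z ` S (X n)) + (1/2) ^ n" for n
      using someI_ex[OF ex[of "X n" n]] unfolding X_def by simp
    have K': "X n \<in> K" for n
    proof (induction n)
      case 0 then show ?case using K by (simp add: X_def)
    next
      case (Suc n) then show ?case using step[of n] unfolding S_def by blast
    qed
    show ?thesis by (rule that[of X]) (use step K' in \<open>auto simp: X_def\<close>)
  qed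
  have chain: "S (X n) \<subseteq> S (X m)" if "m \<le> n" for m n
    using that by (induction rule: dec_induct) (use XS trans in blast)+
  \<comment> \<open>At \<open>X (Suc n)\<close> the functional is within \<open>(1/2) ^ n\<close> of
    its infimum over \<open>S (X n)\<close>, and the gain still possible bounds the
    distance.\<close>
  have small: "norm (w - X (Suc n)) \<le> (1/2) ^ n / \<gamma>" if "w \<in> S (X (Suc n))" for w n
  proof -
    have "w \<in> S (X n)" using that chain[of n "Suc n"] by auto
    then have "Inf (blinfun_apply z ` S (X n)) \<le> z w" by (intro cInf_lower bddS) auto
    then have "\<gamma> * norm (w - X (Suc n)) \<le> (1/2) ^ n"
      using XS[of n] that unfolding S_def by auto
    then show ?thesis using g by (simp add: field_simps)
  qed
  have XinS: "X n \<in> S (X m)" if "m \<le> n" for m n using chain[OF that] self[OF XK] by blast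
  have zero: "(\<lambda>n. (1/2) ^ n / \<gamma>) \<longlonglongrightarrow> 0"
    by (intro tendsto_divide_zero LIMSEQ_realpow_zero) auto
  have "Cauchy X"
  proof (rule metric_CauchyI)
    fix e :: real assume "0 < e"
    then obtain n where n: "(1/2) ^ n / \<gamma> < e / 2"
      using eventually_happens[OF order_tendstoD(2)[OF zero, of "e / 2"]] by auto
    have "dist (X k) (X (Suc n)) < e / 2" if "Suc n \<le> k" for k
      using order.strict_trans1[OF small[OF XinS[OF that]] n] by (simp add: dist_norm)
    then show "\<exists>M. \<forall>m\<ge>M. \<forall>k\<ge>M. dist (X m) (X k) < e"
      by (intro exI[of _ "Suc n"] allI impI) (rule dist_triangle_half_l)
  qed
  then obtain y' where y': "X \<longlonglongrightarrow> y'" using Cauchy_convergent convergent_def by blast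
  have closedS: "closed (S x)" for x
  proof -
    have "S x = K \<inter> {w. z w + \<gamma> * norm (w - x) \<le> z x}" unfolding S_def by auto
    moreover have "closed {w. z w + \<gamma> * norm (w - x) \<le> z x}"
      by (intro closed_Collect_le continuous_intros)
    ultimately show ?thesis using K(1) by auto
  qed
  have y'S: "y' \<in> S (X n)" for n
    by (rule Lim_in_closed_set[OF closedS _ _ y']) (auto intro: eventually_sequentiallyI[of n] XinS)
  \<comment> \<open>A violating \<open>w\<close> lies in every \<open>S (X n)\<close>, so it is the
    limit \<open>y'\<close>, where the inequality is trivial.\<close>
  have "z y' \<le> z w + \<gamma> * norm (w - y')" if "w \<in> K" for w
  proof (rule ccontr)
    assume neg: "\<not> z y' \<le> z w + \<gamma> * norm (w - y')"
    then have "w \<in> S y'" using that unfolding S_def by auto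
    then have wS: "w \<in> S (X n)" for n using trans[OF y'S] by blast
    have "(\<lambda>n. w - X (Suc n)) \<longlonglongrightarrow> 0"
      by (rule Lim_null_comparison[OF _ zero]) (use small[OF wS] in auto)
    moreover have "(\<lambda>n. w - X (Suc n)) \<longlonglongrightarrow> w - y'"
      using y' by (intro tendsto_intros) (simp add: LIMSEQ_Suc)
    ultimately have "w = y'" using LIMSEQ_unique by fastforce
    then show False using neg by simp
  qed
  moreover have "y' \<in> K" "z y' + \<gamma> * norm (y' - y) \<le> z y"
    using y'S[of 0] X0 unfolding S_def by auto
  ultimately show ?thesis using that by blast
qed

subsection \<open>Small slices in a prescribed direction\<close>

lemma blinfun_add_diff_le:
  fixes z z' :: "'a::real_normed_vector \<Rightarrow>\<^sub>L real"
  assumes "norm (z' - z) \<le> \<delta>"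
  shows "z' x \<le> z x + \<delta> * norm x" and "z x \<le> z' x + \<delta> * norm x"
proof -
  have "\<bar>(z' - z) x\<bar> \<le> norm (z' - z) * norm x" using norm_blinfun[of "z' - z" x] by simp
  also have "\<dots> \<le> \<delta> * norm x" using assms by (rule mult_right_mono) simp
  finally show "z' x \<le> z x + \<delta> * norm x" "z x \<le> z' x + \<delta> * norm x"
    by (auto simp: blinfun.diff_left)
qed

lemma convex_halfspace_blinfun: "convex {x. c \<le> blinfun_apply g x}"
  for g :: "'a::real_normed_vector \<Rightarrow>\<^sub>L real"
proof -
  have "{x. c \<le> blinfun_apply g x} = blinfun_apply g -` {c..}" by auto
  then show ?thesis
    using convex_linear_vimage[OF bounded_linear.linear[OF blinfun.bounded_linear_right]]
    by (metis convex_real_interval(1))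
qed

text \<open>Otherwise \<open>A\<close>, and with it its closed convex hull, lies in the
  complementary closed half-space.\<close>

lemma exists_point_in_hull_slice:
  fixes h :: "'a::real_normed_vector \<Rightarrow>\<^sub>L real"
  assumes "{x \<in> closure (convex hull A). h x < a} \<noteq> {}"
  obtains x where "x \<in> A" "h x < a"
proof -
  have "\<not> A \<subseteq> {x. a \<le> h x}"
  proof
    assume "A \<subseteq> {x. a \<le> h x}"
    moreover have "convex {x. a \<le> h x}" by (rule convex_halfspace_blinfun)
    moreover have "closed {x. a \<le> h x}" by (intro closed_Collect_le continuous_intros)
    ultimately have "closure (convex hull A) \<subseteq> {x. a \<le> h x}"
      by (intro closure_minimal hull_minimal)
    with assms show False by force
  qed
  then show ?thesis using that by force
qed

text \<open>A slice of the points at which some functional of the ball is minimal, in an arbitrary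
  direction \<open>h\<close>, contains a minimiser \<open>x\<close> of some \<open>z\<close> in the ball. Perturbing \<open>z\<close> to \<open>z + s h\<close>
  forces near-minimisers into that slice, and does not leave the ball for small \<open>s\<close>.\<close>

lemma small_slice_near_functional:
  fixes g :: "'a::banach \<Rightarrow>\<^sub>L real"
  assumes rnp: "radon_nikodym_property TYPE('a)"
    and K: "closed K" "convex K" "w0 \<in> K" and pos: "0 < \<delta>" "0 < \<kappa>" "0 < \<eta>"
    and coer: "\<And>z y. z \<in> ball g \<delta> \<Longrightarrow> y \<in> K \<Longrightarrow> \<kappa> * norm y \<le> z y + M"
  obtains z c where "z \<in> ball g \<delta>" "{y \<in> K. z y < c} \<noteq> {}"
    "\<And>x y. x \<in> K \<Longrightarrow> y \<in> K \<Longrightarrow> z x < c \<Longrightarrow> z y < c \<Longrightarrow> dist x y \<le> \<eta>"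
proof -
  have low: "- M \<le> z y" if "z \<in> ball g \<delta>" "y \<in> K" for z y
    using coer[OF that] pos(2) by (smt (verit) norm_ge_zero mult_nonneg_nonneg)
  define A where "A = {x \<in> K. \<exists>z \<in> ball g \<delta>. \<forall>w \<in> K. z x \<le> z w}"
  \<comment> \<open>Ekeland moves \<open>y\<close> to an approximate minimiser \<open>x\<close> of
    \<open>z\<close>; Hahn-Banach then moves \<open>z\<close> by at most \<open>\<gamma>\<close>,
    still inside the ball, to a functional minimal at \<open>x\<close>.\<close>
  have near: "\<exists>x \<in> A. z x + \<gamma> * norm (x - y) \<le> z y"
    if z: "z \<in> ball g \<delta>" and y: "y \<in> K" and gam: "0 < \<gamma>" "dist g z + \<gamma> < \<delta>" for z y \<gamma>
  proof -
    obtain x where x: "x \<in> K" "z x + \<gamma> * norm (x - y) \<le> z y"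
      "\<And>w. w \<in> K \<Longrightarrow> z x \<le> z w + \<gamma> * norm (w - x)"
      using Ekeland_blinfun[OF K(1) y low[OF z] gam(1)] by metis
    obtain z' where z': "norm (z' - z) \<le> \<gamma>" "\<And>w. w \<in> K \<Longrightarrow> z' x \<le> z' w"
      using minimiser_of_nearby_functional[OF K(2) x(1) _ x(3)] gam(1) by (metis less_imp_le)
    have "dist g z' \<le> dist g z + dist z z'" by (rule dist_triangle)
    then have "z' \<in> ball g \<delta>" using z'(1) gam by (simp add: dist_norm norm_minus_commute)
    then have "x \<in> A" using x(1) z'(2) unfolding A_def by blast
    then show ?thesis using x(2) by blast
  qed
  define D where "D = closure (convex hull A)"
  \<comment> \<open>Comparison with \<open>w0\<close> and coercivity bound all the minimisers, so
    that the property applies to \<open>D\<close>.\<close>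
  define R where "R = ((norm g + \<delta>) * norm w0 + M) / \<kappa>"
  have "norm x \<le> R" if "x \<in> A" for x
  proof -
    obtain z where z: "z \<in> ball g \<delta>" "z x \<le> z w0" "x \<in> K" using \<open>x \<in> A\<close> K(3) unfolding A_def by auto
    have "norm (z - g) \<le> \<delta>" using z(1) by (simp add: dist_norm norm_minus_commute)
    then have "z w0 \<le> g w0 + \<delta> * norm w0" by (rule blinfun_add_diff_le)
    moreover have "g w0 \<le> norm g * norm w0" using norm_blinfun[of g w0] by simp
    ultimately have "\<kappa> * norm x \<le> (norm g + \<delta>) * norm w0 + M"
      using coer[OF z(1,3)] z(2) by (simp add: algebra_simps)
    then show ?thesis unfolding R_def using pos(2) by (simp add: field_simps)
  qed
  then have "A \<subseteq> cball 0 R" by auto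
  then have "D \<subseteq> cball 0 R" unfolding D_def by (intro closure_minimal hull_minimal) auto
  then have bD: "bounded D" using bounded_cball bounded_subset by blast
  obtain x0 where "x0 \<in> A" using near[of g w0 "\<delta> / 2"] K(3) pos(1) by auto
  have AD: "A \<subseteq> D" unfolding D_def by (rule order_trans[OF hull_subset closure_subset])
  have "D \<noteq> {}" "closed D" "convex D"
    using \<open>x0 \<in> A\<close> AD by (auto simp: D_def convex_closure)
  then have "\<exists>h \<in> sphere (0 :: 'a \<Rightarrow>\<^sub>L real) 1. \<exists>a. {x \<in> D. h x < a} \<noteq> {} \<and>
      diameter {x \<in> D. h x < a} < \<eta> / 2"
    by (intro rnp[unfolded radon_nikodym_property_def, rule_format]) (use bD pos(3) in simp_all)
  then obtain h :: "'a \<Rightarrow>\<^sub>L real" and a where "h \<in> sphere 0 1" and ne: "{x \<in> D. h x < a} \<noteq> {}"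
    and diam: "diameter {x \<in> D. h x < a} < \<eta> / 2"
    by blast
  then have h: "norm h = 1" by simp
  obtain x where x: "x \<in> A" "h x < a" using exists_point_in_hull_slice ne unfolding D_def by metis
  then obtain z where z: "z \<in> ball g \<delta>" "\<And>w. w \<in> K \<Longrightarrow> z x \<le> z w" "x \<in> K" unfolding A_def by auto
  \<comment> \<open>Two steps of length \<open>s\<close> fit inside the ball: one from
    \<open>z\<close> to \<open>z1\<close>, one for applying \<open>near\<close> at
    \<open>z1\<close>.\<close>
  define s where "s = (\<delta> - dist g z) / 3"
  have s: "0 < s" using z(1) unfolding s_def by simp
  define z1 where "z1 = z + s *\<^sub>R h"
  have "dist g z1 \<le> dist g z + dist z z1" by (rule dist_triangle)
  also have "dist z z1 = s" unfolding z1_def using s h by (simp add: dist_norm)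
  finally have gz1: "dist g z1 + s < \<delta>" using s unfolding s_def by (simp add: field_simps)
  then have z1: "z1 \<in> ball g \<delta>" using s by simp
  \<comment> \<open>The first term forces \<open>h y' < a\<close>, the second keeps the move from
    \<open>y\<close> to \<open>y'\<close> within \<open>\<eta> / 8\<close>.\<close>
  define \<tau> where "\<tau> = min (s * (a - h x)) (s * (\<eta> / 8))"
  have \<tau>: "0 < \<tau>" "\<tau> \<le> s * (a - h x)" "\<tau> \<le> s * (\<eta> / 8)" unfolding \<tau>_def using s x pos(3) by auto
  define I where "I = Inf (blinfun_apply z1 ` K)"
  have bdd: "bdd_below (blinfun_apply z1 ` K)" using low[OF z1] by (intro bdd_belowI[of _ "- M"]) auto
  have I: "I \<le> z1 w" if "w \<in> K" for w unfolding I_def using that by (intro cInf_lower bdd) auto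
  have step: "\<exists>y' \<in> D. h y' < a \<and> dist y y' \<le> \<eta> / 8" if y: "y \<in> K" "z1 y < I + \<tau>" for y
  proof -
    obtain y' where y': "y' \<in> A" "z1 y' + s * norm (y' - y) \<le> z1 y"
      using near[OF z1 y(1) s gz1] by blast
    have y'K: "y' \<in> K" using y'(1) unfolding A_def by blast
    have "s * norm (y' - y) < s * (\<eta> / 8)" using y'(2) y(2) I[OF y'K] \<tau>(3) by linarith
    then have d: "dist y y' \<le> \<eta> / 8" using s by (simp add: dist_norm norm_minus_commute)
    have "0 \<le> s * norm (y' - y)" using s by simp
    then have "z1 y' < z1 x + \<tau>" using y'(2) y(2) I[OF z(3)] by linarith
    then have "z y' + s * h y' < z x + s * h x + \<tau>"
      unfolding z1_def by (simp add: blinfun.add_left blinfun.scaleR_left)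
    \<comment> \<open>Since \<open>x\<close> minimises \<open>z\<close>, the \<open>z\<close>-terms
      cancel and leave a bound on \<open>h y'\<close> alone.\<close>
    then have "s * h y' < s * a" using z(2)[OF y'K] \<tau>(2) by (simp add: algebra_simps)
    then have "h y' < a" using s by simp
    then show ?thesis using d y'(1) AD by blast
  qed
  show ?thesis
  proof (rule that[OF z1, of "I + \<tau>"])
    have "blinfun_apply z1 ` K \<noteq> {}" using K(3) by blast
    then obtain y where "y \<in> K" "z1 y < I + \<tau>"
      using cInf_lessD[of "blinfun_apply z1 ` K" "I + \<tau>"] \<tau>(1) unfolding I_def by auto
    then show "{y \<in> K. z1 y < I + \<tau>} \<noteq> {}" by blast
    fix u v assume uv: "u \<in> K" "v \<in> K" "z1 u < I + \<tau>" "z1 v < I + \<tau>"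
    obtain u' where u': "u' \<in> D" "h u' < a" "dist u u' \<le> \<eta> / 8" using step uv by blast
    obtain v' where v': "v' \<in> D" "h v' < a" "dist v v' \<le> \<eta> / 8" using step uv by blast
    have "dist u' v' \<le> diameter {x \<in> D. h x < a}"
      by (rule diameter_bounded_bound) (use u' v' bD in \<open>auto intro: bounded_subset\<close>)
    then have "dist u' v' \<le> \<eta> / 2" using diam by simp
    moreover have "dist u v \<le> dist u u' + dist u' v' + dist v v'"
      by (smt (verit) dist_commute dist_triangle)
    ultimately show "dist u v \<le> \<eta>" using u'(3) v'(3) pos(3) by linarith
  qed
qed

text \<open>The functional \<open>g'\<close> and all functionals near it separate the slice from \<open>A\<close>; the uniformity in
  \<open>t\<close> makes the separation survive the passage to limits of functionals.\<close>

lemma small_slice_separated: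
  fixes f g g1 :: "'a::banach \<Rightarrow>\<^sub>L real"
  assumes rnp: "radon_nikodym_property TYPE('a)"
    and K: "closed K" "convex K" "A \<subseteq> K" "x0 \<in> K"
    and Km: "\<And>y. y \<in> K \<Longrightarrow> - m \<le> f y - \<rho> * norm y"
    and ball: "ball g r \<subseteq> ball f \<rho>" and g1: "g1 \<in> ball g r"
    and sep: "g1 x0 < c1" "\<And>y. y \<in> A \<Longrightarrow> c1 \<le> g1 y" and eta: "0 < \<eta>"
  obtains g' c' r' where "0 < r'" "r' \<le> \<eta>" "cball g' r' \<subseteq> ball g r" "{y \<in> K. g' y < c'} \<noteq> {}"
    "\<And>x y. x \<in> K \<Longrightarrow> y \<in> K \<Longrightarrow> g' x < c' \<Longrightarrow> g' y < c' \<Longrightarrow> dist x y \<le> \<eta>"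
    "\<And>x y t. x \<in> K \<Longrightarrow> g' x < c' \<Longrightarrow> y \<in> A \<Longrightarrow> t \<in> cball g' r' \<Longrightarrow> t x < t y"
proof -
  \<comment> \<open>Functionals within \<open>\<kappa>\<close> of \<open>g1\<close> stay within
    \<open>\<rho> - \<kappa>\<close> of \<open>f\<close>; the spare \<open>\<kappa>\<close> makes
    them coercive on \<open>K\<close>.\<close>
  define \<kappa> where "\<kappa> = (\<rho> - dist f g1) / 2"
  have "g1 \<in> ball f \<rho>" using ball g1 by blast
  then have \<kappa>: "0 < \<kappa>" unfolding \<kappa>_def by simp
  have coer: "\<kappa> * norm y \<le> z y + m" if z: "z \<in> ball g1 \<kappa>" and y: "y \<in> K" for z y
  proof -
    have "dist f z \<le> dist f g1 + dist g1 z" by (rule dist_triangle)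
    then have "norm (z - f) \<le> \<rho> - \<kappa>"
      using z unfolding \<kappa>_def by (simp add: dist_norm norm_minus_commute field_simps)
    then have "f y \<le> z y + (\<rho> - \<kappa>) * norm y" by (rule blinfun_add_diff_le)
    then show ?thesis using Km[OF y] by (simp add: algebra_simps)
  qed
  \<comment> \<open>One radius for all sets \<open>{x \<in> K. z x \<le> z x0 + 1}\<close> with
    \<open>z\<close> in \<open>ball g1 \<kappa>\<close>.\<close>
  define R where "R = ((norm g1 + \<kappa>) * norm x0 + 1 + m) / \<kappa>"
  have bound: "norm x \<le> R" if z: "z \<in> ball g1 \<kappa>" and x: "x \<in> K" "z x \<le> z x0 + 1" for z x
  proof -
    have "norm (z - g1) \<le> \<kappa>" using z by (simp add: dist_norm norm_minus_commute)
    then have "z x0 \<le> g1 x0 + \<kappa> * norm x0" by (rule blinfun_add_diff_le)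
    moreover have "g1 x0 \<le> norm g1 * norm x0" using norm_blinfun[of g1 x0] by simp
    ultimately have "\<kappa> * norm x \<le> (norm g1 + \<kappa>) * norm x0 + 1 + m"
      using coer[OF z x(1)] x(2) by (simp add: algebra_simps)
    then show ?thesis unfolding R_def using \<kappa> by (simp add: field_simps)
  qed
  have R0: "norm x0 \<le> R" using bound[of g1 x0] \<kappa> K(4) by simp
  then have R: "0 \<le> R" using norm_ge_zero order_trans by blast
  define \<theta> where "\<theta> = min 1 (c1 - g1 x0) / 8"
  have \<theta>: "0 < \<theta>" "8 * \<theta> \<le> 1" "8 * \<theta> \<le> c1 - g1 x0" unfolding \<theta>_def using sep(1) by auto
  \<comment> \<open>Moving a functional by \<open>2 * \<delta>\<close> changes it by at most
    \<open>\<theta>\<close> on the ball of radius \<open>R\<close>, and keeps it in both balls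
    around \<open>g1\<close> and \<open>g\<close>. The \<open>R + 1\<close> avoids division by
    zero.\<close>
  define \<delta> where "\<delta> = min (min \<kappa> (r - dist g g1)) (\<theta> / (R + 1)) / 2"
  have \<delta>: "0 < \<delta>" "2 * \<delta> \<le> \<kappa>" "2 * \<delta> \<le> r - dist g g1" "2 * \<delta> \<le> \<theta> / (R + 1)"
    unfolding \<delta>_def using \<kappa> g1 \<theta>(1) R by auto
  have "2 * \<delta> * R \<le> 2 * \<delta> * (R + 1)" using \<delta>(1) by simp
  also have "\<dots> \<le> \<theta>" using \<delta>(4) R by (simp add: field_simps)
  finally have \<delta>R: "2 * \<delta> * R \<le> \<theta>" .
  obtain g' c where g': "g' \<in> ball g1 \<delta>" "{y \<in> K. g' y < c} \<noteq> {}"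
    and small: "\<And>x y. x \<in> K \<Longrightarrow> y \<in> K \<Longrightarrow> g' x < c \<Longrightarrow> g' y < c \<Longrightarrow> dist x y \<le> \<eta>"
  proof (rule small_slice_near_functional[OF rnp K(1,2,4) \<delta>(1) \<kappa> eta])
    show "\<kappa> * norm y \<le> z y + m" if "z \<in> ball g1 \<delta>" "y \<in> K" for z y
      using that coer[of z y] \<delta>(1,2) by auto
  qed blast
  \<comment> \<open>The cap keeps the slice bounded by \<open>R\<close> and its values not far above
    the one at \<open>x0\<close>; when the cap is the smaller term, \<open>x0\<close> itself lies in
    the slice.\<close>
  define c' where "c' = min c (g' x0 + \<theta>)"
  define r' where "r' = min \<delta> \<eta>"
  have r': "0 < r'" "r' \<le> \<delta>" "r' \<le> \<eta>" unfolding r'_def using \<delta> eta by auto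
  have near: "dist g1 t \<le> 2 * \<delta>" if "t \<in> cball g' r'" for t
    using that g'(1) r' dist_triangle[of g1 t g'] by auto
  have strict: "dist g1 t < 2 * \<delta>" if "t \<in> cball g' r'" for t
    using that g'(1) r' dist_triangle[of g1 t g'] by auto
  show ?thesis
  proof (rule that[OF r'(1,3), of g' c'])
    show "cball g' r' \<subseteq> ball g r"
    proof
      fix t assume "t \<in> cball g' r'"
      then show "t \<in> ball g r" using strict[of t] \<delta>(3) dist_triangle[of g t g1] by simp
    qed
    obtain p where "p \<in> K" "g' p < c" using g'(2) by blast
    then have "g' x0 < c' \<or> g' p < c'" using \<theta>(1) unfolding c'_def by linarith
    then show "{y \<in> K. g' y < c'} \<noteq> {}" using K(4) \<open>p \<in> K\<close> by blast
    show "dist x y \<le> \<eta>" if "x \<in> K" "y \<in> K" "g' x < c'" "g' y < c'" for x y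
      using small that unfolding c'_def by auto
    show "t x < t y" if x: "x \<in> K" "g' x < c'" and y: "y \<in> A" and t: "t \<in> cball g' r'" for x y t
    proof (rule ccontr)
      \<comment> \<open>Then \<open>t y\<close> is at most slightly above \<open>t x0\<close>, so
        \<open>norm y \<le> R\<close>, and comparing \<open>t\<close> with \<open>g1\<close> costs
        at most \<open>4 * \<theta>\<close> in all, which is less than the gap
        \<open>c1 - g1 x0\<close>.\<close>
      assume "\<not> t x < t y"
      then have tyx: "t y \<le> t x" by simp
      have g'x: "g' x < g' x0 + \<theta>" using x(2) unfolding c'_def by simp
      have xR: "norm x \<le> R"
        using bound[of g' x] g'x \<theta> g'(1) \<delta> x(1) by auto
      have t1: "t \<in> ball g1 \<kappa>" using strict[OF t] \<delta>(2) by simp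
      have "norm (t - g') \<le> \<delta>" using t r' by (simp add: dist_norm norm_minus_commute)
      note tg = blinfun_add_diff_le[OF this]
      have "norm (t - g1) \<le> 2 * \<delta>" using near[OF t] by (simp add: dist_norm norm_minus_commute)
      note tg1 = blinfun_add_diff_le[OF this]
      have mono: "\<delta> * norm u \<le> \<delta> * R" if "norm u \<le> R" for u :: 'a
        using that \<delta>(1) by (intro mult_left_mono) auto
      have "t x \<le> g' x + \<delta> * R" using tg(1)[of x] mono[OF xR] by simp
      also have "\<dots> \<le> g' x0 + \<theta> + \<delta> * R" using g'x by simp
      also have "\<dots> \<le> t x0 + \<theta> + 2 * \<delta> * R" using tg(2)[of x0] mono[OF R0] by linarith
      finally have tx: "t x \<le> t x0 + 2 * \<theta>" using \<delta>R by simp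
      have yK: "y \<in> K" using y K(3) by blast
      have yR: "norm y \<le> R" using bound[OF t1 yK] tx tyx \<theta> by simp
      have "g1 y \<le> t y + 2 * \<delta> * R" using tg1(2)[of y] mono[OF yR] by simp
      also have "\<dots> \<le> t x0 + 3 * \<theta>" using tyx tx \<delta>R by simp
      also have "\<dots> \<le> g1 x0 + 4 * \<theta>" using tg1(1)[of x0] mono[OF R0] \<delta>R by simp
      also have "\<dots> < c1" using \<theta> by simp
      finally show False using sep(2)[OF y] by simp
    qed
  qed
qed

subsection \<open>Transfinite slicing\<close>

text \<open>Slices are cut off \<open>B\<close> one after the other, until only \<open>A\<close> is left; \<open>ix x\<close> is the time at which
  \<open>x\<close> is removed and \<open>KK i\<close> is what is left at time \<open>i\<close>. There are enough times by Cantor's theorem.\<close>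

lemma transfinite_slicing:
  fixes A B :: "'a::real_normed_vector set" and G :: "'a set \<Rightarrow> 'a \<Rightarrow>\<^sub>L real" and c :: "'a set \<Rightarrow> real"
    and W :: "'a set rel"
  assumes W: "wf W" "trans W" "total W"
    and AB: "closed B" "convex B" "A \<subseteq> B"
    and Gc: "\<And>K. closed K \<Longrightarrow> convex K \<Longrightarrow> A \<subseteq> K \<Longrightarrow> K \<subseteq> B \<Longrightarrow> K \<noteq> A \<Longrightarrow>
              {x \<in> K. G K x < c K} \<noteq> {} \<and> (\<forall>y \<in> A. c K \<le> G K y)"
  obtains ix :: "'a \<Rightarrow> 'a set" and KK :: "'a set \<Rightarrow> 'a set" where
    "\<And>i. closed (KK i) \<and> convex (KK i) \<and> A \<subseteq> KK i \<and> KK i \<subseteq> B"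
    "\<And>x. x \<in> B - A \<Longrightarrow> x \<in> KK (ix x) \<and> KK (ix x) \<noteq> A \<and> G (KK (ix x)) x < c (KK (ix x))"
    "\<And>x y. x \<in> B - A \<Longrightarrow> y \<in> B - A \<Longrightarrow> y \<notin> {y \<in> KK (ix x). c (KK (ix x)) \<le> G (KK (ix x)) y} \<Longrightarrow>
       ix y = ix x \<or> (ix y, ix x) \<in> W"
proof -
  \<comment> \<open>What is left of \<open>B\<close> after all earlier slices; the guard
    \<open>Kf j \<noteq> A\<close> stops the slicing once \<open>A\<close> is reached.\<close>
  define H where "H Kf i = B \<inter> {x. \<forall>j. (j, i) \<in> W \<longrightarrow> Kf j \<noteq> A \<longrightarrow> c (Kf j) \<le> G (Kf j) x}"
    for Kf :: "'a set \<Rightarrow> 'a set" and i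
  define KK where "KK = wfrec W H"
  have KK: "KK i = H KK i" for i
  proof -
    have "KK i = H (cut KK W i) i" unfolding KK_def by (rule wfrec[OF W(1)])
    also have "\<dots> = H KK i" unfolding H_def by (auto simp: cut_apply)
    finally show ?thesis .
  qed
  define cutoff where "cutoff j x \<longleftrightarrow> KK j \<noteq> A \<and> G (KK j) x < c (KK j)" for j x
  have mem: "x \<in> KK i \<longleftrightarrow> x \<in> B \<and> (\<forall>j. (j, i) \<in> W \<longrightarrow> \<not> cutoff j x)" for x i
    by (subst KK) (auto simp: H_def cutoff_def not_less)
  have cc: "closed (KK i)" "convex (KK i)" for i
  proof -
    have eq: "H KK i = B \<inter> (\<Inter>j \<in> {j. (j, i) \<in> W \<and> KK j \<noteq> A}. {x. c (KK j) \<le> G (KK j) x})"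
      unfolding H_def by auto
    have "closed (H KK i)"
      unfolding eq using AB(1)
      by (intro closed_Int closed_INT ballI closed_Collect_le continuous_intros)
    moreover have "convex (H KK i)"
      unfolding eq using AB(2) by (intro convex_Int convex_INT convex_halfspace_blinfun)
    ultimately show "closed (KK i)" "convex (KK i)" by (simp_all add: KK[of i])
  qed
  have sub: "KK i \<subseteq> B" for i using mem by blast
  have sup: "A \<subseteq> KK i" for i
  proof (induction i rule: wf_induct_rule[OF W(1)])
    case (1 i)
    then have "\<not> cutoff j x" if "(j, i) \<in> W" "x \<in> A" for j x
      using Gc[OF cc[of j] _ sub[of j]] that 1[of j] unfolding cutoff_def by (meson linorder_not_le)
    then show ?case using mem AB(3) by blast
  qed
  have slice: "\<exists>x. x \<in> KK i \<and> cutoff i x" if "KK i \<noteq> A" for i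
    using Gc[OF cc sup sub that] that unfolding cutoff_def by blast
  have removed: "\<exists>i. cutoff i x" if x: "x \<in> B - A" for x
  proof (rule ccontr)
    assume "\<not> ?thesis"
    then have "x \<in> KK i" for i using mem x by blast
    then have "KK i \<noteq> A" for i using x by blast
    \<comment> \<open>A point cut off at one time is missing at all later times, so
      \<open>pt\<close> would inject the power set of the space into the space.\<close>
    then obtain pt where pt: "\<And>i. pt i \<in> KK i \<and> cutoff i (pt i)" using slice by metis
    have "inj pt"
    proof (rule injI, rule ccontr)
      fix i j assume "pt i = pt j" "i \<noteq> j"
      then show False using pt mem W(3) unfolding total_on_def by (metis UNIV_I)
    qed
    then have "range (inv pt) = UNIV" by (rule inj_imp_surj_inv)
    then show False using Cantors_theorem[of "UNIV :: 'a set"] by auto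
  qed
  define ix where "ix x = (SOME i. cutoff i x \<and> (\<forall>j. (j, i) \<in> W \<longrightarrow> \<not> cutoff j x))" for x
  have ix: "cutoff (ix x) x \<and> (\<forall>j. (j, ix x) \<in> W \<longrightarrow> \<not> cutoff j x)" if "x \<in> B - A" for x
  proof -
    obtain i where i: "i \<in> {i. cutoff i x}" using removed \<open>x \<in> B - A\<close> by blast
    have "\<exists>k \<in> {i. cutoff i x}. \<forall>j. (j, k) \<in> W \<longrightarrow> j \<notin> {i. cutoff i x}"
      by (rule wf_eq_minimal[THEN iffD1, OF W(1), rule_format, OF i])
    then have "\<exists>k. cutoff k x \<and> (\<forall>j. (j, k) \<in> W \<longrightarrow> \<not> cutoff j x)" by simp
    then show ?thesis unfolding ix_def by (rule someI_ex)
  qed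
  show ?thesis
  proof (rule that[of KK ix])
    show "closed (KK i) \<and> convex (KK i) \<and> A \<subseteq> KK i \<and> KK i \<subseteq> B" for i
      using cc sub sup by blast
    show "x \<in> KK (ix x) \<and> KK (ix x) \<noteq> A \<and> G (KK (ix x)) x < c (KK (ix x))" if "x \<in> B - A" for x
      using ix[OF that] mem that unfolding cutoff_def by blast
    show "ix y = ix x \<or> (ix y, ix x) \<in> W"
      if x: "x \<in> B - A" and y: "y \<in> B - A"
        and ny: "y \<notin> {y \<in> KK (ix x). c (KK (ix x)) \<le> G (KK (ix x)) y}" for x y
    proof -
      \<comment> \<open>Outside the remainder, \<open>y\<close> is cut off at time
        \<open>ix x\<close> or earlier, and its first time \<open>ix y\<close> is no later than
        that.\<close>
      have "\<exists>i. (i = ix x \<or> (i, ix x) \<in> W) \<and> cutoff i y"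
        using ny mem y ix[OF x] unfolding cutoff_def by (metis (mono_tags, lifting) DiffD1 linorder_not_le mem_Collect_eq)
      then obtain i where i: "i = ix x \<or> (i, ix x) \<in> W" "cutoff i y" by blast
      then have "(i, ix y) \<notin> W" using ix[OF y] by blast
      then have "ix y = i \<or> (ix y, i) \<in> W" using W(3) unfolding total_on_def by blast
      then show ?thesis using i(1) W(2) by (metis transD)
    qed
  qed
qed

subsection \<open>The tree of nested slicings\<close>

text \<open>A node stands for the points of \<open>upper - lower\<close>; the functionals used below it are taken from
  the ball \<open>B(centre, radius)\<close>.\<close>

datatype ('a, 'b) slab = Node (upper: "'a set") (lower: "'a set") (centre: 'b) (radius: real)

type_synonym 'a node = "('a, 'a \<Rightarrow>\<^sub>L real) slab"

abbreviation cell :: "'a::real_normed_vector node \<Rightarrow> 'a set" where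
  "cell N \<equiv> upper N - lower N"

text \<open>The invariant that allows further slicing: the lower bound on
  \<open>f - \<rho> * norm\<close> gives coercivity, and the last clause supplies the functional
  from which \<open>small_slice_separated\<close> starts.\<close>

definition admissible :: "('a::real_normed_vector \<Rightarrow>\<^sub>L real) \<Rightarrow> real \<Rightarrow> 'a node \<Rightarrow> bool" where
  "admissible f \<rho> N \<longleftrightarrow>
     closed (upper N) \<and> convex (upper N) \<and> lower N \<subseteq> upper N \<and>
     (\<exists>m. \<forall>y \<in> upper N. - m \<le> f y - \<rho> * norm y) \<and>
     0 < radius N \<and> ball (centre N) (radius N) \<subseteq> ball f \<rho> \<and>
     (\<forall>x \<in> cell N. \<exists>g \<in> ball (centre N) (radius N). \<exists>c. g x < c \<and> (\<forall>y \<in> lower N. c \<le> g y))"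

text \<open>The last clause separates the child's cell from the lower set of the parent, one level
  up. It holds on the whole closed ball, hence for a functional common to the balls of all
  levels.\<close>

definition is_child :: "real \<Rightarrow> 'a::real_normed_vector node \<Rightarrow> 'a node \<Rightarrow> bool" where
  "is_child \<eta> N M \<longleftrightarrow>
     radius M \<le> \<eta> \<and> cball (centre M) (radius M) \<subseteq> ball (centre N) (radius N) \<and>
     (\<forall>u \<in> cell M. \<forall>v \<in> cell M. dist u v \<le> \<eta>) \<and>
     (\<forall>u \<in> cell M. \<forall>v \<in> lower N. \<forall>t \<in> cball (centre M) (radius M). t u < t v)"

text \<open>Every \<open>K\<close> strictly above \<open>lower N\<close> has a small separated
  slice, and transfinite slicing runs through these. The child of \<open>x\<close> is the slice
  removed together with \<open>x\<close>; its lower set is what is left afterwards, so a point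
  outside that set was removed no later than \<open>x\<close>.\<close>

lemma admissible_refine:
  fixes f :: "'a::banach \<Rightarrow>\<^sub>L real" and W :: "'a set rel"
  assumes rnp: "radon_nikodym_property TYPE('a)"
    and W: "wf W" "trans W" "total W" and adm: "admissible f \<rho> N" and eta: "0 < \<eta>"
  shows "\<exists>ch ix. \<forall>x \<in> cell N. admissible f \<rho> (ch x) \<and> is_child \<eta> N (ch x) \<and> x \<in> cell (ch x) \<and>
    (\<forall>y \<in> cell N. y \<notin> lower (ch x) \<longrightarrow>
       ix y = ix x \<and> ch y = ch x \<or> (ix y :: 'a set, ix x) \<in> W)"
proof -
  define A B g r where "A = lower N" and "B = upper N" and "g = centre N" and "r = radius N"
  note defs = A_def B_def g_def r_def
  obtain m where B: "closed B" "convex B" "A \<subseteq> B" and m: "\<And>y. y \<in> B \<Longrightarrow> - m \<le> f y - \<rho> * norm y"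
    and ball: "ball g r \<subseteq> ball f \<rho>"
    and sep: "\<And>x. x \<in> B - A \<Longrightarrow> \<exists>g1 \<in> ball g r. \<exists>c. g1 x < c \<and> (\<forall>y \<in> A. c \<le> g1 y)"
    using adm unfolding admissible_def defs by blast
  define P where "P K \<longleftrightarrow> closed K \<and> convex K \<and> A \<subseteq> K \<and> K \<subseteq> B \<and> K \<noteq> A" for K
  define Q where "Q K g' c' r' \<longleftrightarrow> 0 < r' \<and> r' \<le> \<eta> \<and> cball g' r' \<subseteq> ball g r \<and> {y \<in> K. blinfun_apply g' y < c'} \<noteq> {} \<and>
      (\<forall>x y. x \<in> K \<and> y \<in> K \<and> g' x < c' \<and> g' y < c' \<longrightarrow> dist x y \<le> \<eta>) \<and>
      (\<forall>x y t. x \<in> K \<and> g' x < c' \<and> y \<in> A \<and> t \<in> cball g' r' \<longrightarrow> blinfun_apply t x < t y)" for K g' c' r'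
  have "\<exists>g' c' r'. P K \<longrightarrow> Q K g' c' r'" for K
  proof (cases "P K")
    case True
    then have K: "closed K" "convex K" "A \<subseteq> K" "K \<subseteq> B" unfolding P_def by auto
    obtain x0 where x0: "x0 \<in> K" "x0 \<notin> A" using True unfolding P_def by blast
    then obtain g1 c where g1: "g1 \<in> ball g r" "g1 x0 < c" "\<And>y. y \<in> A \<Longrightarrow> c \<le> g1 y"
      using sep K(4) by blast
    have Km: "- m \<le> f y - \<rho> * norm y" if "y \<in> K" for y using m K(4) that by blast
    obtain g' c' r' where "Q K g' c' r'"
    proof (rule small_slice_separated[OF rnp K(1,2,3) x0(1) Km ball g1 eta])
      show thesis
        if "0 < r'" "r' \<le> \<eta>" "cball g' r' \<subseteq> ball g r" "{y \<in> K. g' y < c'} \<noteq> {}"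
          "\<And>x y. x \<in> K \<Longrightarrow> y \<in> K \<Longrightarrow> g' x < c' \<Longrightarrow> g' y < c' \<Longrightarrow> dist x y \<le> \<eta>"
          "\<And>x y t. x \<in> K \<Longrightarrow> g' x < c' \<Longrightarrow> y \<in> A \<Longrightarrow> t \<in> cball g' r' \<Longrightarrow> t x < t y" for g' c' r'
        by (rule \<open>\<And>g' c' r'. Q K g' c' r' \<Longrightarrow> thesis\<close>[of g' c' r']) (use that in \<open>unfold Q_def, blast\<close>)
    qed blast
    then show ?thesis by blast
  qed blast
  then obtain G c rr where GQ: "\<And>K. P K \<Longrightarrow> Q K (G K) (c K) (rr K)" by metis
  \<comment> \<open>Otherwise \<open>y\<close> lies in the slice and is separated from itself by
    \<open>G K\<close>.\<close>
  have above: "c K \<le> G K y" if "P K" "y \<in> A" for K y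
  proof (rule ccontr)
    assume "\<not> c K \<le> G K y"
    moreover have "y \<in> K" "0 < rr K" using that GQ[OF that(1)] unfolding P_def Q_def by auto
    moreover from this have "G K \<in> cball (G K) (rr K)" by simp
    ultimately have "G K y < G K y" using that(2) GQ[OF that(1)] unfolding Q_def not_le by blast
    then show False by simp
  qed
  have "{x \<in> K. G K x < c K} \<noteq> {} \<and> (\<forall>y \<in> A. c K \<le> G K y)"
    if "closed K" "convex K" "A \<subseteq> K" "K \<subseteq> B" "K \<noteq> A" for K
  proof -
    have "P K" using that unfolding P_def by blast
    then show ?thesis using GQ above unfolding Q_def by blast
  qed
  then obtain ix KK where
    KK: "\<And>i. closed (KK i) \<and> convex (KK i) \<and> A \<subseteq> KK i \<and> KK i \<subseteq> B"
    and xK: "\<And>x. x \<in> B - A \<Longrightarrow> x \<in> KK (ix x) \<and> KK (ix x) \<noteq> A \<and> G (KK (ix x)) x < c (KK (ix x))"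
    and ix: "\<And>x y. x \<in> B - A \<Longrightarrow> y \<in> B - A \<Longrightarrow> y \<notin> {y \<in> KK (ix x). c (KK (ix x)) \<le> G (KK (ix x)) y} \<Longrightarrow>
       ix y = ix x \<or> (ix y, ix x) \<in> W"
    by (rule transfinite_slicing[OF W B]) blast+
  define nd where "nd K = Node K {y \<in> K. c K \<le> G K y} (G K) (rr K)" for K
  have cell: "cell (nd K) = {y \<in> K. G K y < c K}" for K unfolding nd_def by auto
  show ?thesis
  proof (intro exI[of _ "\<lambda>x. nd (KK (ix x))"] exI[of _ ix] ballI)
    fix x assume "x \<in> cell N"
    then have x: "x \<in> B - A" unfolding defs .
    define K where "K = KK (ix x)"
    have PK: "P K" using KK[of "ix x"] xK[OF x] unfolding P_def K_def by auto
    note q = GQ[OF PK, unfolded Q_def]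
    have "admissible f \<rho> (nd K)"
      unfolding admissible_def cell
    proof (intro conjI ballI)
      show "closed (upper (nd K))" "convex (upper (nd K))" "lower (nd K) \<subseteq> upper (nd K)"
        using PK unfolding nd_def P_def by auto
      show "\<exists>m. \<forall>y \<in> upper (nd K). - m \<le> f y - \<rho> * norm y"
        using m PK unfolding nd_def P_def by (intro exI[of _ m]) auto
      show "0 < radius (nd K)" using q unfolding nd_def by simp
      have "ball (G K) (rr K) \<subseteq> ball g r" using q ball_subset_cball by (metis order_trans)
      then show "ball (centre (nd K)) (radius (nd K)) \<subseteq> ball f \<rho>"
        using ball unfolding nd_def by simp
      show "\<exists>g \<in> ball (centre (nd K)) (radius (nd K)). \<exists>c. g u < c \<and> (\<forall>y \<in> lower (nd K). c \<le> g y)"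
        if "u \<in> {y \<in> K. G K y < c K}" for u
        using q that unfolding nd_def by (intro bexI[of _ "G K"] exI[of _ "c K"]) auto
    qed
    moreover have "is_child \<eta> N (nd K)"
      unfolding is_child_def cell
    proof (intro conjI ballI)
      show "radius (nd K) \<le> \<eta>" using q unfolding nd_def by simp
      show "cball (centre (nd K)) (radius (nd K)) \<subseteq> ball (centre N) (radius N)"
        using q unfolding nd_def defs by simp
      show "dist u v \<le> \<eta>" if "u \<in> {y \<in> K. G K y < c K}" "v \<in> {y \<in> K. G K y < c K}" for u v
        using q that by blast
      show "t u < t v" if "u \<in> {y \<in> K. G K y < c K}" "v \<in> lower N" "t \<in> cball (centre (nd K)) (radius (nd K))" for u v t
        using q that unfolding nd_def A_def by simp
    qed
    moreover have "x \<in> cell (nd K)" using xK[OF x] unfolding cell K_def by simp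
    moreover have "ix y = ix x \<and> nd (KK (ix y)) = nd K \<or> (ix y, ix x) \<in> W"
      if "y \<in> cell N" "y \<notin> lower (nd K)" for y
    proof -
      have "y \<in> B - A" using that(1) unfolding defs .
      then have "ix y = ix x \<or> (ix y, ix x) \<in> W"
        using ix[OF x, of y] that(2) unfolding nd_def K_def by simp
      then show ?thesis unfolding K_def by auto
    qed
    ultimately show "admissible f \<rho> (nd (KK (ix x))) \<and> is_child \<eta> N (nd (KK (ix x))) \<and>
        x \<in> cell (nd (KK (ix x))) \<and>
        (\<forall>y \<in> cell N. y \<notin> lower (nd (KK (ix x))) \<longrightarrow>
          ix y = ix x \<and> nd (KK (ix y)) = nd (KK (ix x)) \<or> (ix y, ix x) \<in> W)"
      unfolding K_def by blast
  qed
qed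

section \<open>The layers of the whole space\<close>

definition root_node :: "('a::real_normed_vector \<Rightarrow>\<^sub>L real) \<Rightarrow> real \<Rightarrow> real \<Rightarrow> 'a node" where
  "root_node f \<rho> m = Node {y. - m \<le> f y - \<rho> * norm y} {y. - (m - 1) \<le> f y - \<rho> * norm y} f \<rho>"

text \<open>The layers are bounded by superlevel sets of the concave function
  \<open>f - \<rho> * norm\<close>. With \<open>h\<close> norming \<open>x\<close>, the functional
  \<open>f - \<rho>' *\<^sub>R h\<close> dominates this function everywhere;
  \<open>\<rho>' < \<rho>\<close> puts it in the open ball.\<close>

lemma admissible_root_node:
  fixes f :: "'a::real_normed_vector \<Rightarrow>\<^sub>L real"
  assumes rho: "0 < \<rho>"
  shows "admissible f \<rho> (root_node f \<rho> m)"
  unfolding admissible_def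
proof (intro conjI ballI)
  have up: "upper (root_node f \<rho> m) = {y. - m \<le> f y - \<rho> * norm y}"
    and lo: "lower (root_node f \<rho> m) = {y. - (m - 1) \<le> f y - \<rho> * norm y}"
    and ce: "centre (root_node f \<rho> m) = f" "radius (root_node f \<rho> m) = \<rho>"
    unfolding root_node_def by simp_all
  show "closed (upper (root_node f \<rho> m))"
    unfolding up by (intro closed_Collect_le continuous_intros)
  show "convex (upper (root_node f \<rho> m))"
    unfolding up convex_def
  proof (intro ballI allI impI, unfold mem_Collect_eq)
    fix x y and u v :: real
    assume x: "- m \<le> f x - \<rho> * norm x" and y: "- m \<le> f y - \<rho> * norm y"
      and uv: "0 \<le> u" "0 \<le> v" "u + v = 1"
    have "norm (u *\<^sub>R x + v *\<^sub>R y) \<le> u * norm x + v * norm y"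
      using norm_triangle_ineq[of "u *\<^sub>R x" "v *\<^sub>R y"] uv by simp
    then have "\<rho> * norm (u *\<^sub>R x + v *\<^sub>R y) \<le> \<rho> * (u * norm x + v * norm y)"
      using rho by simp
    moreover have "u * (- m) + v * (- m) \<le> u * (f x - \<rho> * norm x) + v * (f y - \<rho> * norm y)"
      using x y uv by (intro add_mono mult_left_mono)
    moreover have "u * (- m) + v * (- m) = - m" using uv(3) by (metis distrib_right mult_1)
    ultimately show "- m \<le> f (u *\<^sub>R x + v *\<^sub>R y) - \<rho> * norm (u *\<^sub>R x + v *\<^sub>R y)"
      by (simp add: blinfun.add_right blinfun.scaleR_right algebra_simps)
  qed
  show "lower (root_node f \<rho> m) \<subseteq> upper (root_node f \<rho> m)" unfolding up lo by auto
  show "\<exists>m'. \<forall>y \<in> upper (root_node f \<rho> m). - m' \<le> f y - \<rho> * norm y" unfolding up by auto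
  show "0 < radius (root_node f \<rho> m)" using rho ce by simp
  show "ball (centre (root_node f \<rho> m)) (radius (root_node f \<rho> m)) \<subseteq> ball f \<rho>" using ce by simp
  fix x assume "x \<in> cell (root_node f \<rho> m)"
  then have x: "f x - \<rho> * norm x < - (m - 1)" unfolding lo by auto
  define d where "d = - (m - 1) - (f x - \<rho> * norm x)"
  \<comment> \<open>Lowering \<open>\<rho>\<close> by this amount raises the value at
    \<open>x\<close> by at most half of the gap \<open>d\<close>.\<close>
  define \<rho>' where "\<rho>' = max 0 (\<rho> - d / (2 * (norm x + 1)))"
  have d: "0 < d" using x unfolding d_def by simp
  have "d / (2 * (norm x + 1)) * norm x \<le> d / 2"
    using d norm_ge_zero[of x] by (simp add: divide_simps mult_left_le) (smt (verit) norm_ge_zero)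
  then have "(\<rho> - d / (2 * (norm x + 1))) * norm x \<ge> \<rho> * norm x - d / 2"
    by (simp add: algebra_simps)
  moreover have "\<rho>' * norm x \<ge> (\<rho> - d / (2 * (norm x + 1))) * norm x"
    unfolding \<rho>'_def by (intro mult_right_mono) auto
  moreover have "f x - \<rho> * norm x = - (m - 1) - d" unfolding d_def by simp
  ultimately have "f x - \<rho>' * norm x < - (m - 1)" using d by linarith
  have r': "0 \<le> \<rho>'" "\<rho>' < \<rho>"
  proof -
    have "0 < 2 * (norm x + 1)" by (intro mult_pos_pos add_nonneg_pos) simp_all
    then have "0 < d / (2 * (norm x + 1))" using d by (rule divide_pos_pos[rotated])
    then show "0 \<le> \<rho>'" "\<rho>' < \<rho>" unfolding \<rho>'_def using rho by simp_all
  qed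
  obtain h :: "'a \<Rightarrow>\<^sub>L real" where h: "norm h \<le> 1" "h x = norm x" by (rule norming_functional)
  define g where "g = f - \<rho>' *\<^sub>R h"
  have "norm (f - g) \<le> \<rho>'" unfolding g_def using h(1) r'(1) by (simp add: mult_left_le)
  then have "g \<in> ball (centre (root_node f \<rho> m)) (radius (root_node f \<rho> m))"
    unfolding ce using r'(2) by (simp add: dist_norm)
  moreover have "g x = f x - \<rho>' * norm x"
    unfolding g_def using h(2) by (simp add: blinfun.diff_left blinfun.scaleR_left)
  moreover have "- (m - 1) \<le> g y" if "y \<in> lower (root_node f \<rho> m)" for y
  proof -
    have "norm (f - g) \<le> \<rho>" using \<open>norm (f - g) \<le> \<rho>'\<close> r'(2) by simp
    then have "f y \<le> g y + \<rho> * norm y" by (rule blinfun_add_diff_le)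
    then show ?thesis using that unfolding lo by simp
  qed
  moreover note \<open>f x - \<rho>' * norm x < - (m - 1)\<close>
  ultimately show "\<exists>g \<in> ball (centre (root_node f \<rho> m)) (radius (root_node f \<rho> m)).
      \<exists>c. g x < c \<and> (\<forall>y \<in> lower (root_node f \<rho> m). c \<le> g y)"
    by (intro bexI[of _ g] exI[of _ "- (m - 1)"]) auto
qed

section \<open>Choice of the functionals and convergence of the sequences\<close>

lemma wf_descent_eventually_constant:
  fixes s :: "nat \<Rightarrow> 'b"
  assumes W: "wf W" and step: "\<And>k. k0 \<le> k \<Longrightarrow> s (Suc k) = s k \<or> (s (Suc k), s k) \<in> W"
  obtains k1 where "k0 \<le> k1" "\<And>k. k1 \<le> k \<Longrightarrow> s k = s k1"
proof -
  have "s k0 \<in> s ` {k0..}" by simp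
  then obtain v where v: "v \<in> s ` {k0..}" "\<And>w. (w, v) \<in> W \<Longrightarrow> w \<notin> s ` {k0..}"
    using wf_eq_minimal[THEN iffD1, OF W, rule_format, of "s k0" "s ` {k0..}"] by blast
  then obtain k1 where k1: "k0 \<le> k1" "s k1 = v" by auto
  have "s k = s k1" if "k1 \<le> k" for k
    using that
  proof (induction rule: dec_induct)
    case (step k)
    then have "s (Suc k) \<in> s ` {k0..}" using k1 by auto
    then have "(s (Suc k), v) \<notin> W" using v(2) by blast
    then show ?case using assms(2)[of k] step k1 by auto
  qed simp
  then show ?thesis using that k1 by blast
qed

text \<open>\<open>t x\<close> is a common point of the nested balls along the branch of
  \<open>x\<close>, so it separates \<open>x\<close> from the lower set at every level. A step that
  does not increase \<open>t (X k)\<close> avoids all these sets, so the removal times descend and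
  the nodes stabilise level by level.\<close>

lemma exists_convergence_forcing_functional:
  fixes f :: "'a::banach \<Rightarrow>\<^sub>L real"
  assumes rnp: "radon_nikodym_property TYPE('a)" and rho: "0 < \<rho>"
  obtains t :: "'a \<Rightarrow> 'a \<Rightarrow>\<^sub>L real" where "\<And>x. t x \<in> ball f \<rho>"
    "\<And>X. bdd_below (range (\<lambda>n. f (X n) - \<rho> * norm (X n))) \<Longrightarrow>
        (\<And>n. t (X n) (X (Suc n)) \<le> t (X n) (X n)) \<Longrightarrow> convergent X"
proof -
  obtain R :: "'a set rel" where R: "Well_order R" "Field R = UNIV" 
    using well_ordering[where 'a = "'a set"] by (elim exE conjE)
  define W where "W = R - Id"
  have "wf (R - Id)" "trans R" "antisym R" "total R"
    using R unfolding well_order_on_def linear_order_on_def partial_order_on_def preorder_on_def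
    by simp_all
  then have W: "wf W" "trans W" "total W"
    unfolding W_def by (simp_all add: trans_diff_Id)
  define refines where "refines n N ch ix \<longleftrightarrow> (\<forall>x \<in> cell N. admissible f \<rho> (ch x) \<and>
      is_child ((1/2) ^ n) N (ch x) \<and> x \<in> cell (ch x) \<and>
      (\<forall>y \<in> cell N. y \<notin> lower (ch x) \<longrightarrow> ix y = ix x \<and> ch y = ch x \<or> (ix y, ix x) \<in> W))"
    for n :: nat and N and ch :: "'a \<Rightarrow> 'a node" and ix :: "'a \<Rightarrow> 'a set"
  have ex_refines: "\<exists>p. admissible f \<rho> N \<longrightarrow> refines n N (fst p) (snd p)" for n N
    using admissible_refine[OF rnp W, of f \<rho> N "(1/2) ^ n"] unfolding refines_def by auto
  \<comment> \<open>The choice depends on the level and the node only, so that points in the same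
    node have comparable indices.\<close>
  define p where "p n N = (SOME p. admissible f \<rho> N \<longrightarrow> refines n N (fst p) (snd p))" for n N
  define ch ix where "ch n N = fst (p n N)" and "ix n N = snd (p n N)" for n N
  have "admissible f \<rho> N \<longrightarrow> refines n N (ch n N) (ix n N)" for n N
    unfolding ch_def ix_def p_def by (rule someI_ex[OF ex_refines])
  then have ch: "\<And>n N x. admissible f \<rho> N \<Longrightarrow> x \<in> cell N \<Longrightarrow>
      admissible f \<rho> (ch n N x) \<and> is_child ((1/2) ^ n) N (ch n N x) \<and> x \<in> cell (ch n N x)"
    and ix: "\<And>n N x y. admissible f \<rho> N \<Longrightarrow> x \<in> cell N \<Longrightarrow> y \<in> cell N \<Longrightarrow> y \<notin> lower (ch n N x) \<Longrightarrow>
      ix n N y = ix n N x \<and> ch n N y = ch n N x \<or> (ix n N y :: 'a set, ix n N x) \<in> W"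
    unfolding refines_def by blast+
  \<comment> \<open>The integer \<open>m\<close> with
    \<open>- m \<le> f x - \<rho> * norm x < - (m - 1)\<close>.\<close>
  define mm where "mm x = \<lceil>\<rho> * norm x - f x\<rceil>" for x
  define N where "N n x = rec_nat (root_node f \<rho> (mm x)) (\<lambda>n M. ch n M x) n" for n x
  have N0: "N 0 x = root_node f \<rho> (mm x)" and NS: "N (Suc n) x = ch n (N n x) x" for n x
    unfolding N_def by simp_all
  have N: "admissible f \<rho> (N n x) \<and> x \<in> cell (N n x)" for n x
  proof (induction n)
    case 0
    have "x \<in> cell (root_node f \<rho> (mm x))"
      unfolding root_node_def mm_def using ceiling_correct[of "\<rho> * norm x - f x"] by simp linarith
    then show ?case using admissible_root_node[OF rho] unfolding N0 by blast
  next
    case (Suc n)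
    then show ?case using ch unfolding NS by blast
  qed
  have child: "is_child ((1/2) ^ n) (N n x) (N (Suc n) x)" for n x using ch N unfolding NS by blast
  define S where "S x n = cball (centre (N n x)) (radius (N n x))" for x n
  have nest1: "S x (Suc n) \<subseteq> ball (centre (N n x)) (radius (N n x))" for x n
    using child unfolding is_child_def S_def by blast
  then have nest: "S x (Suc n) \<subseteq> S x n" for x n
    unfolding S_def using ball_subset_cball by (metis order_trans)
  have "\<exists>t. \<forall>n. t \<in> S x n" for x
  proof (rule decreasing_closed_nest[of "S x"])
    show "closed (S x n)" for n unfolding S_def by simp
    show "S x n \<noteq> {}" for n using N[of n x] unfolding S_def admissible_def by auto
    show "S x n \<subseteq> S x m" if "m \<le> n" for m n
      using lift_Suc_antimono_le[of "S x", OF nest that] .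
    fix e :: real assume "0 < e"
    then obtain n where n: "(1/2::real) ^ n < e / 2"
      using real_arch_pow_inv[of "e / 2" "1/2"] by auto
    have rad: "radius (N (Suc n) x) < e / 2" using child[of n x] n unfolding is_child_def by simp
    have "dist u v < e" if "u \<in> S x (Suc n)" "v \<in> S x (Suc n)" for u v
      using that rad dist_triangle3[of u v "centre (N (Suc n) x)"] unfolding S_def by simp
    then show "\<exists>n. \<forall>u \<in> S x n. \<forall>v \<in> S x n. dist u v < e" by blast
  qed blast
  then obtain t where t: "\<And>x n. t x \<in> S x n" by metis
  have tball: "t x \<in> ball f \<rho>" for x
    using t[of x "Suc 0"] nest1[of x 0] N[of 0 x] unfolding admissible_def by blast
  \<comment> \<open>The ball of level \<open>Suc n\<close> contains \<open>t x\<close> and separates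
    the cell of that level, which contains \<open>x\<close>, from the lower set of level
    \<open>n\<close>.\<close>
  have sep: "t x x < t x v" if "v \<in> lower (N n x)" for x v n
    using child[of n x] N[of "Suc n" x] t[of x "Suc n"] that unfolding is_child_def S_def by blast
  show ?thesis
  proof (rule that[of t])
    show "t x \<in> ball f \<rho>" for x by (rule tball)
    fix X assume bdd: "bdd_below (range (\<lambda>n. f (X n) - \<rho> * norm (X n)))"
      and step: "\<And>n. t (X n) (X (Suc n)) \<le> t (X n) (X n)"
    have notlow: "X (Suc k) \<notin> lower (N n (X k))" for n k
      using sep[of "X (Suc k)" n "X k"] step[of k] by auto
    obtain b where b: "\<And>k. b \<le> f (X k) - \<rho> * norm (X k)"
      using bdd unfolding bdd_below_def by auto
    have mono: "mm (X k) \<le> mm (X (Suc k))" for k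
    proof -
      have "\<not> - (real_of_int (mm (X k)) - 1) \<le> f (X (Suc k)) - \<rho> * norm (X (Suc k))"
        using notlow[of k 0] unfolding N0 root_node_def by simp
      then show ?thesis unfolding mm_def[of "X (Suc k)"] by linarith
    qed
    have le: "mm (X k) \<le> \<lceil>- b\<rceil>" for k
      unfolding mm_def using b[of k] by (intro ceiling_mono) simp
    have const: "\<exists>k0. \<forall>k\<ge>k0. N n (X k) = N n (X k0)" for n
    proof (induction n)
      case 0
      \<comment> \<open>The layer index increases and is bounded by
        \<open>\<lceil>- b\<rceil>\<close>; its distance to that bound is a descending natural
        number.\<close>
      obtain k0 where k0: "\<And>k. k0 \<le> k \<Longrightarrow> nat (\<lceil>- b\<rceil> - mm (X k)) = nat (\<lceil>- b\<rceil> - mm (X k0))"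
      proof (rule wf_descent_eventually_constant[OF wf_less_than, of 0 "\<lambda>k. nat (\<lceil>- b\<rceil> - mm (X k))"])
        show "nat (\<lceil>- b\<rceil> - mm (X (Suc k))) = nat (\<lceil>- b\<rceil> - mm (X k)) \<or>
            (nat (\<lceil>- b\<rceil> - mm (X (Suc k))), nat (\<lceil>- b\<rceil> - mm (X k))) \<in> less_than" for k
          using mono[of k] by auto
      qed blast
      have "N 0 (X k) = N 0 (X k0)" if "k0 \<le> k" for k
      proof -
        have "mm (X k) = mm (X k0)" using k0[OF that] le[of k] le[of k0] by simp
        then show ?thesis unfolding N0 by (rule arg_cong)
      qed
      then show ?case by blast
    next
      case (Suc n)
      then obtain k0 where k0: "\<And>k. k0 \<le> k \<Longrightarrow> N n (X k) = N n (X k0)" by blast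
      define M where "M = N n (X k0)"
      have M: "admissible f \<rho> M" "X k \<in> cell M" "N (Suc n) (X k) = ch n M (X k)" if "k0 \<le> k" for k
        using N[of n "X k"] k0[OF that] NS[of n "X k"] unfolding M_def by auto
      have st: "ix n M (X (Suc k)) = ix n M (X k) \<and> ch n M (X (Suc k)) = ch n M (X k) \<or>
          (ix n M (X (Suc k)), ix n M (X k)) \<in> W" if "k0 \<le> k" for k
        using ix[OF M(1,2)[OF that] M(2)[of "Suc k"]] notlow[of k "Suc n"] M(3)[OF that] that by simp
      obtain k1 where k1: "k0 \<le> k1" "\<And>k. k1 \<le> k \<Longrightarrow> ix n M (X k) = ix n M (X k1)"
        by (rule wf_descent_eventually_constant[OF W(1), of k0 "\<lambda>k. ix n M (X k)"]) (use st in blast)+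
      \<comment> \<open>Equal indices give equal children once the strict alternative is
        excluded.\<close>
      have irr: "(i, i) \<notin> W" for i unfolding W_def by simp
      have "ch n M (X k) = ch n M (X k1)" if "k1 \<le> k" for k
        using that
      proof (induction rule: dec_induct)
        case (step k)
        have "ix n M (X (Suc k)) = ix n M (X k)" using k1(2)[of k] k1(2)[of "Suc k"] step by simp
        then show ?case using st[of k] irr step k1(1) by auto
      qed simp
      then have "N (Suc n) (X k) = N (Suc n) (X k1)" if "k1 \<le> k" for k
        unfolding M(3)[OF order_trans[OF k1(1) that]] M(3)[OF k1(1)] using that .
      then show ?case by blast
    qed
    have "Cauchy X"
    proof (rule metric_CauchyI)
      fix e :: real assume "0 < e"
      then obtain n where n: "(1/2::real) ^ n < e"
        using real_arch_pow_inv[of e "1/2"] by auto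
      obtain k0 where k0: "\<And>k. k0 \<le> k \<Longrightarrow> N (Suc n) (X k) = N (Suc n) (X k0)" using const by blast
      have "X k \<in> cell (N (Suc n) (X k0))" if "k0 \<le> k" for k
        using N[of "Suc n" "X k"] k0[OF that] by simp
      then have "dist (X k) (X l) \<le> (1/2) ^ n" if "k0 \<le> k" "k0 \<le> l" for k l
        using child[of n "X k0"] that unfolding is_child_def by blast
      then show "\<exists>M. \<forall>m\<ge>M. \<forall>n\<ge>M. dist (X m) (X n) < e" using n by force
    qed
    then show "convergent X" by (rule Cauchy_convergent)
  qed
qed

text \<open>Normalising moves \<open>t\<close> by the difference between its norm and 1, which is
  less than \<open>\<rho>\<close>; this doubling is why \<open>t\<close> is sought in the ball of
  radius \<open>\<epsilon> / 2\<close>.\<close>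

lemma norm_normalise_diff:
  fixes t f :: "'b::real_normed_vector"
  assumes "norm f = 1" "norm (t - f) < \<rho>" "\<rho> \<le> 1"
  shows "norm (sgn t) = 1" "norm (sgn t - f) < 2 * \<rho>"
proof -
  have n: "\<bar>norm t - 1\<bar> < \<rho>" using norm_triangle_ineq3[of t f] assms by simp
  then have "t \<noteq> 0" using assms(3) by auto
  then show "norm (sgn t) = 1" by (simp add: norm_sgn)
  have "sgn t - t = (1 - norm t) *\<^sub>R sgn t"
    using \<open>t \<noteq> 0\<close> by (simp add: sgn_div_norm algebra_simps)
  then have "norm (sgn t - t) = \<bar>1 - norm t\<bar>" using \<open>norm (sgn t) = 1\<close> by simp
  then show "norm (sgn t - f) < 2 * \<rho>"
    using n assms(2) norm_triangle_ineq[of "sgn t - t" "t - f"] by simp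
qed

subsection \<open>The converse\<close>

text \<open>Of two points of the slice more than \<open>2 * \<eta> / 3\<close> apart, one is at
  least \<open>\<eta> / 3\<close> from \<open>c\<close>.\<close>

lemma exists_far_point_in_slice:
  assumes bdd: "bounded C" and diam: "\<eta> \<le> diameter {x \<in> C. P x}" and eta: "0 < \<eta>"
  obtains y where "y \<in> C" "P y" "\<eta> / 3 \<le> dist y c"
proof -
  have b: "bounded {x \<in> C. P x}" by (rule bounded_subset[OF bdd]) auto
  have "2 * \<eta> / 3 < diameter {x \<in> C. P x}" using diam eta by simp
  then obtain x y where xy: "x \<in> C" "P x" "y \<in> C" "P y" "2 * \<eta> / 3 < dist x y"
    using diameter_lower_bounded[OF b, of "2 * \<eta> / 3"] eta by auto
  then have "\<eta> / 3 \<le> dist x c \<or> \<eta> / 3 \<le> dist y c" using dist_triangle2[of x y c] by linarith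
  then show ?thesis using that xy by blast
qed

text \<open>Minimising over \<open>C\<close> only gives near-descent \<open>t y < t c + \<tau>\<close>; the error is absorbed by moving
  the point off \<open>C\<close> by a summable amount.\<close>

lemma nondentable_imp_bad_sequence:
  fixes t :: "'a::banach \<Rightarrow> 'a \<Rightarrow>\<^sub>L real"
  assumes t: "\<And>x. norm (t x) = 1" and not: "\<not> radon_nikodym_property TYPE('a)"
  obtains X where "bounded (range X)" "\<And>n. t (X n) (X (Suc n) - X n) \<le> 0" "\<not> convergent X"
proof -
  obtain C :: "'a set" and \<eta> where eta: "0 < \<eta>" and C: "C \<noteq> {}" "bounded C"
    and none: "\<not> (\<exists>g \<in> sphere (0 :: 'a \<Rightarrow>\<^sub>L real) 1. \<exists>c. {x \<in> C. g x < c} \<noteq> {} \<and>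
        diameter {x \<in> C. g x < c} < \<eta>)"
    using not unfolding radon_nikodym_property_def by blast
  have big: "\<eta> \<le> diameter {x \<in> C. blinfun_apply g x < c}"
    if "norm g = 1" "{x \<in> C. blinfun_apply g x < c} \<noteq> {}" for g :: "'a \<Rightarrow>\<^sub>L real" and c
  proof -
    have "g \<in> sphere 0 1" using that(1) by simp
    then show ?thesis using that(2) none by (meson linorder_not_le)
  qed
  \<comment> \<open>The displacements \<open>2 * \<tau> n\<close> sum to \<open>\<eta> / 8\<close>,
    which is small against the jumps \<open>\<eta> / 3\<close> within \<open>C\<close>.\<close>
  define \<tau> where "\<tau> n = \<eta> / 32 * (1/2) ^ n" for n :: nat
  have \<tau>: "0 < \<tau> n" "2 * \<tau> n \<le> \<eta> / 16" for n
    unfolding \<tau>_def using eta power_le_one[of "1/2::real" n] by auto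
  have step: "\<exists>c' u'. c' \<in> C \<and> norm (u' - u) \<le> 2 * \<tau> n \<and> \<eta> / 3 \<le> dist c' c \<and>
      t (c + u) (c' + u') \<le> t (c + u) (c + u)" if c: "c \<in> C" for c u n
  proof -
    define g where "g = t (c + u)"
    have g: "norm g = 1" unfolding g_def by (rule t)
    have "c \<in> {x \<in> C. g x < g c + \<tau> n}" using c \<tau> by simp
    then have "\<eta> \<le> diameter {x \<in> C. g x < g c + \<tau> n}" using big[OF g] by blast
    then obtain y where y: "y \<in> C" "g y < g c + \<tau> n" "\<eta> / 3 \<le> dist y c"
      by (rule exists_far_point_in_slice[OF C(2) _ eta])
    \<comment> \<open>A functional of norm 1 exceeds any value below 1 on the unit ball;
      \<open>1/2\<close> is enough here.\<close>
    obtain v where v: "norm v \<le> 1" "1/2 \<le> g v"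
    proof (rule ccontr)
      assume "\<not> thesis"
      then have no: "g v < 1/2" if "norm v \<le> 1" for v using that \<open>\<And>v. norm v \<le> 1 \<Longrightarrow> 1 / 2 \<le> g v \<Longrightarrow> thesis\<close> by force
      have "norm (g x) \<le> 1/2 * norm x" for x
      proof (cases "x = 0")
        case False
        have "g (sgn x) < 1/2" "g (- sgn x) < 1/2" using no by (auto simp: norm_sgn)
        then have "\<bar>g (sgn x)\<bar> \<le> 1/2" by (simp add: blinfun.minus_right)
        then show ?thesis
          using False by (simp add: sgn_div_norm blinfun.scaleR_right abs_mult field_simps)
      qed simp
      then have "norm g \<le> 1/2" by (intro norm_blinfun_bound) auto
      then show False using g by simp
    qed
    \<comment> \<open>Moving by \<open>2 * \<tau> n\<close> against \<open>v\<close> lowers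
      \<open>g\<close> by at least \<open>\<tau> n\<close>, which absorbs the error.\<close>
    define u' where "u' = u - (2 * \<tau> n) *\<^sub>R v"
    have "norm (u' - u) \<le> 2 * \<tau> n" unfolding u'_def using v(1) \<tau>(1)[of n] by (simp add: mult_left_le)
    moreover have "2 * \<tau> n * g v \<ge> \<tau> n" using mult_left_mono[OF v(2), of "2 * \<tau> n"] \<tau>(1)[of n] by simp
    then have "g (y + u') \<le> g (c + u)"
      using y(2) unfolding u'_def by (simp add: blinfun.add_right blinfun.diff_right blinfun.scaleR_right)
    ultimately show ?thesis using y unfolding g_def by blast
  qed
  obtain c0 where c0: "c0 \<in> C" using C by blast
  have "\<exists>p. \<forall>n. fst (p n) \<in> C \<and> (fst (p (Suc n)) \<in> C \<and> norm (snd (p (Suc n)) - snd (p n)) \<le> 2 * \<tau> n \<and>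
      \<eta> / 3 \<le> dist (fst (p (Suc n))) (fst (p n)) \<and>
      t (fst (p n) + snd (p n)) (fst (p (Suc n)) + snd (p (Suc n))) \<le> t (fst (p n) + snd (p n)) (fst (p n) + snd (p n)))"
  proof (rule dependent_nat_choice[where P = "\<lambda>n q. fst q \<in> C"])
    show "\<exists>q. fst q \<in> C" using c0 by auto
    show "\<exists>q'. fst q' \<in> C \<and> (fst q' \<in> C \<and> norm (snd q' - snd q) \<le> 2 * \<tau> n \<and> \<eta> / 3 \<le> dist (fst q') (fst q) \<and>
      t (fst q + snd q) (fst q' + snd q') \<le> t (fst q + snd q) (fst q + snd q))" if "fst q \<in> C" for q :: "'a \<times> 'a" and n
      using step[OF that, of "snd q" n] by auto
  qed
  then obtain p where p: "\<And>n. fst (p n) \<in> C" "\<And>n. norm (snd (p (Suc n)) - snd (p n)) \<le> 2 * \<tau> n"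
      "\<And>n. \<eta> / 3 \<le> dist (fst (p (Suc n))) (fst (p n))"
      "\<And>n. t (fst (p n) + snd (p n)) (fst (p (Suc n)) + snd (p (Suc n))) \<le> t (fst (p n) + snd (p n)) (fst (p n) + snd (p n))"
    by blast
  define X where "X n = fst (p n) + snd (p n)" for n
  have "norm (snd (p n)) \<le> norm (snd (p 0)) + \<eta> / 8 * (1 - (1/2) ^ n)" for n
  proof (induction n)
    case (Suc n)
    have "norm (snd (p (Suc n))) \<le> norm (snd (p n)) + 2 * \<tau> n"
      using p(2)[of n] norm_triangle_sub[of "snd (p (Suc n))" "snd (p n)"] by linarith
    then show ?case using Suc unfolding \<tau>_def by (simp add: algebra_simps)
  qed simp
  moreover have "\<eta> / 8 * (1 - (1/2) ^ n) \<le> \<eta> / 8" for n using eta by simp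
  ultimately have un: "norm (snd (p n)) \<le> norm (snd (p 0)) + \<eta> / 8" for n by (meson add_left_mono order_trans)
  obtain b where b: "\<And>x. x \<in> C \<Longrightarrow> norm x \<le> b" using C(2) unfolding bounded_iff by blast
  have "norm (X n) \<le> b + (norm (snd (p 0)) + \<eta> / 8)" for n
    unfolding X_def using norm_triangle_ineq[of "fst (p n)" "snd (p n)"] b[OF p(1)] un[of n] by (meson add_mono order_trans)
  then have "bounded (range X)" unfolding bounded_iff by blast
  moreover have "t (X n) (X (Suc n) - X n) \<le> 0" for n
    using p(4)[of n] unfolding X_def by (simp add: blinfun.diff_right)
  moreover have "\<not> convergent X"
  proof
    assume "convergent X"
    then have "Cauchy X" by (rule convergent_Cauchy)
    then obtain M where "\<And>m n. M \<le> m \<Longrightarrow> M \<le> n \<Longrightarrow> dist (X m) (X n) < \<eta> / 8"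
      using metric_CauchyD[of X "\<eta> / 8"] eta by auto
    then have "dist (X (Suc M)) (X M) < \<eta> / 8" by simp
    \<comment> \<open>The jump in \<open>C\<close> is the jump of \<open>X\<close> less the change
      of displacement, so it would be below \<open>\<eta> / 8 + \<eta> / 16\<close>, against
      \<open>\<eta> / 3\<close>.\<close>
    moreover have "fst (p (Suc M)) - fst (p M) = (X (Suc M) - X M) - (snd (p (Suc M)) - snd (p M))"
      unfolding X_def by simp
    ultimately have "dist (fst (p (Suc M))) (fst (p M)) < \<eta> / 8 + 2 * \<tau> M"
      using norm_triangle_ineq4[of "X (Suc M) - X M" "snd (p (Suc M)) - snd (p M)"] p(2)[of M]
      by (simp add: dist_norm)
    then show False using p(3)[of M] \<tau>(2)[of M] eta by simp
  qed
  ultimately show ?thesis using that by blast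
qed

section \<open>The two implications for functionals on the unit sphere\<close>

theorem mainTheorem3:
  fixes f :: "'a::banach \<Rightarrow>\<^sub>L real" and \<epsilon> :: real
  assumes "f \<in> sphere 0 1" and "0 < \<epsilon>" and "\<epsilon> < 1"
  shows "radon_nikodym_property TYPE('a) \<longleftrightarrow>
    (\<exists>t :: 'a \<Rightarrow> ('a \<Rightarrow>\<^sub>L real).
       (\<forall>x. t x \<in> sphere 0 1 \<inter> ball f \<epsilon>) \<and>
       (\<forall>x :: nat \<Rightarrow> 'a.
          bdd_below (range (\<lambda>n. blinfun_apply f (x n) - \<epsilon> * norm (x n))) \<longrightarrow>
          (\<forall>n. blinfun_apply (t (x n)) (x (Suc n) - x n) \<le> 0) \<longrightarrow>
          convergent x))"
proof
  assume rnp: "radon_nikodym_property TYPE('a)"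
  obtain t where t: "\<And>x. t x \<in> ball f (\<epsilon> / 2)"
    and conv: "\<And>X. bdd_below (range (\<lambda>n. f (X n) - \<epsilon> / 2 * norm (X n))) \<Longrightarrow>
        (\<And>n. t (X n) (X (Suc n)) \<le> t (X n) (X n)) \<Longrightarrow> convergent X"
    using exists_convergence_forcing_functional[OF rnp, of "\<epsilon> / 2" f] assms(2) by auto
  have f: "norm f = 1" using assms(1) by simp
  have near: "norm (t x - f) < \<epsilon> / 2" for x
    using t[of x] by (simp add: dist_norm norm_minus_commute)
  have sg: "norm (sgn (t x)) = 1" "norm (sgn (t x) - f) < \<epsilon>" for x
    using norm_normalise_diff[OF f near[of x]] assms(3) by auto
  show "\<exists>t :: 'a \<Rightarrow> ('a \<Rightarrow>\<^sub>L real).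
       (\<forall>x. t x \<in> sphere 0 1 \<inter> ball f \<epsilon>) \<and>
       (\<forall>x :: nat \<Rightarrow> 'a.
          bdd_below (range (\<lambda>n. blinfun_apply f (x n) - \<epsilon> * norm (x n))) \<longrightarrow>
          (\<forall>n. blinfun_apply (t (x n)) (x (Suc n) - x n) \<le> 0) \<longrightarrow>
          convergent x)"
  proof (intro exI[of _ "\<lambda>x. sgn (t x)"] conjI allI impI)
    show "sgn (t x) \<in> sphere 0 1 \<inter> ball f \<epsilon>" for x
      using sg[of x] by (simp add: dist_norm norm_minus_commute)
    fix X :: "nat \<Rightarrow> 'a"
    assume bdd: "bdd_below (range (\<lambda>n. f (X n) - \<epsilon> * norm (X n)))"
      and dec: "\<forall>n. sgn (t (X n)) (X (Suc n) - X n) \<le> 0"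
    obtain b where b: "\<And>n. b \<le> f (X n) - \<epsilon> * norm (X n)" using bdd unfolding bdd_below_def by auto
    show "convergent X"
    proof (rule conv)
      \<comment> \<open>A lower bound with weight \<open>\<epsilon>\<close> is also one with weight
        \<open>\<epsilon> / 2\<close>.\<close>
      have "b \<le> f (X n) - \<epsilon> / 2 * norm (X n)" for n
      proof -
        have "0 \<le> \<epsilon> * norm (X n)" using assms(2) by simp
        then show ?thesis using b[of n] by simp
      qed
      then show "bdd_below (range (\<lambda>n. f (X n) - \<epsilon> / 2 * norm (X n)))"
        by (intro bdd_belowI[of _ b]) auto
      fix n
      have "0 < norm (t (X n))" using sg(1)[of "X n"] by (auto simp: norm_sgn split: if_splits)
      then show "t (X n) (X (Suc n)) \<le> t (X n) (X n)"
        using dec[rule_format, of n]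
        by (simp add: sgn_div_norm blinfun.scaleR_left blinfun.diff_right field_simps)
    qed
  qed
next
  assume "\<exists>t :: 'a \<Rightarrow> ('a \<Rightarrow>\<^sub>L real).
       (\<forall>x. t x \<in> sphere 0 1 \<inter> ball f \<epsilon>) \<and>
       (\<forall>x :: nat \<Rightarrow> 'a.
          bdd_below (range (\<lambda>n. blinfun_apply f (x n) - \<epsilon> * norm (x n))) \<longrightarrow>
          (\<forall>n. blinfun_apply (t (x n)) (x (Suc n) - x n) \<le> 0) \<longrightarrow>
          convergent x)"
  then obtain t :: "'a \<Rightarrow> 'a \<Rightarrow>\<^sub>L real" where t: "\<And>x. norm (t x) = 1"
    and conv: "\<And>X. bdd_below (range (\<lambda>n. f (X n) - \<epsilon> * norm (X n))) \<Longrightarrow>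
        (\<And>n. t (X n) (X (Suc n) - X n) \<le> 0) \<Longrightarrow> convergent X"
    by auto
  show "radon_nikodym_property TYPE('a)"
  proof (rule ccontr)
    assume "\<not> radon_nikodym_property TYPE('a)"
    then obtain X where X: "bounded (range X)" "\<And>n. t (X n) (X (Suc n) - X n) \<le> 0" "\<not> convergent X"
      using nondentable_imp_bad_sequence[where t = t, OF t] by metis
    obtain b where b: "\<And>n. norm (X n) \<le> b" using X(1) unfolding bounded_iff by auto
    \<comment> \<open>Along a bounded sequence the boundedness hypothesis holds
      automatically.\<close>
    have "- ((1 + \<epsilon>) * b) \<le> f (X n) - \<epsilon> * norm (X n)" for n
    proof -
      have "\<bar>f (X n)\<bar> \<le> norm (X n)" using norm_blinfun[of f "X n"] assms(1) by simp
      moreover have "\<epsilon> * norm (X n) \<le> \<epsilon> * b" using b[of n] assms(2) by simp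
      ultimately show ?thesis using b[of n] by (simp add: algebra_simps)
    qed
    then have "bdd_below (range (\<lambda>n. f (X n) - \<epsilon> * norm (X n)))"
      by (intro bdd_belowI[of _ "- ((1 + \<epsilon>) * b)"]) auto
    then show False using conv X by blast
  qed
qed

end
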